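(* Let $M\ge2$ be the number of frequencies and $N\ge1$ the number of resonators, with cubic nonlinearity, and consider the associated system of polynomial equations (described for general $N$ in the context). For one resonator, $N=1$, it is the system of $2M$ equations $p_1=q_1=\cdots=p_M=q_M=0$ in the $2M$ variables $u=(u_1,\ldots,u_M)$, $v=(v_1,\ldots,v_M)$, where for $k=1,\ldots,M$ $$\begin{aligned}p_k(u,v)&=a_{k,0}+a_{k,1}u_k+c_kv_k+d_ku_k(u_k^2+v_k^2)+2d_k\sum_{j\ne k}u_k(u_j^2+v_j^2),\\ q_k(u,v)&=b_{k,0}-c_ku_k+b_{k,1}v_k+d_kv_k(u_k^2+v_k^2)+2d_k\sum_{j\ne k}v_k(u_j^2+v_j^2).\end{aligned}$$ For general coefficients the system has at least $5^{MN}$ complex solutions. For $M=2$ and $N=1$ there are exactly $5^{MN}=25$ complex solutions.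
   Context: "General" means: outside a proper algebraic subvariety of the space of coefficients. The system arises by the Harmonic Balance method, with an ansatz using $M$ frequencies, from nonlinear resonators with cubic nonlinearity. For $N$ coupled resonators the equations of motion are $$\ddot X_i+\omega_0^2(1-\lambda\cos(2t\omega))X_i+\gamma\dot X_i+\alpha X_i^3+\sum_{l\ne i}J_{i,l}X_l=0,\qquad i=1,\ldots,N,$$ and the polynomial system consists of $N$ blocks, one for each resonator, each block being of the form displayed in the claim in its own $2M$ variables and with its own coefficients, with additional linear terms coupling different resonators; in total there are $2MN$ equations in $2MN$ variables. *)

theory Defs
  imports "HOL-Analysis.Analysis" "HOL-Library.Poly_Mapping"
begin

section \<open>Polynomials on a coefficient space and generality\<close>

text \<open>
  A polynomial in variables indexed by \<open>'i\<close> is a finitely supported map from exponent vectors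
  \<open>'i \<Rightarrow>\<^sub>0 nat\<close> to coefficients. The affine space of coefficients of a system is \<open>'i \<Rightarrow> complex\<close>
  for a finite index type \<open>'i\<close>.
\<close>

definition poly_value :: "(('i \<Rightarrow>\<^sub>0 nat) \<Rightarrow>\<^sub>0 complex) \<Rightarrow> ('i \<Rightarrow> complex) \<Rightarrow> complex" where
  "poly_value P x =
    (\<Sum>e\<in>Poly_Mapping.keys P. Poly_Mapping.lookup P e *
      (\<Prod>i\<in>Poly_Mapping.keys e. x i ^ Poly_Mapping.lookup e i))"

definition algebraic_subvariety :: "('i \<Rightarrow> complex) set \<Rightarrow> bool" where
  "algebraic_subvariety Z \<longleftrightarrow>
    (\<exists>S :: (('i \<Rightarrow>\<^sub>0 nat) \<Rightarrow>\<^sub>0 complex) set. Z = {x. \<forall>P\<in>S. poly_value P x = 0})"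

definition for_general :: "(('i \<Rightarrow> complex) \<Rightarrow> bool) \<Rightarrow> bool" where
  "for_general Q \<longleftrightarrow> (\<exists>Z. algebraic_subvariety Z \<and> Z \<noteq> UNIV \<and> (\<forall>x. x \<notin> Z \<longrightarrow> Q x))"

section \<open>The block of a single resonator\<close>

text \<open>
  The type \<open>'m\<close> indexes the frequencies. The constructors \<open>A0 k\<close>, \<open>A1 k\<close>, \<open>B0 k\<close>, \<open>B1 k\<close>, \<open>C k\<close>,
  \<open>D k\<close> name the coefficients $a_{k,0}$, $a_{k,1}$, $b_{k,0}$, $b_{k,1}$, $c_k$, $d_k$.
\<close>

datatype 'm block_coeff = A0 'm | A1 'm | B0 'm | B1 'm | C 'm | D 'm

definition block_p ::
  "('m::finite block_coeff \<Rightarrow> complex) \<Rightarrow> complex ^ 'm \<Rightarrow> complex ^ 'm \<Rightarrow> 'm \<Rightarrow> complex" where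
  "block_p a u v k =
    a (A0 k) + a (A1 k) * u $ k + a (C k) * v $ k
    + a (D k) * u $ k * ((u $ k)\<^sup>2 + (v $ k)\<^sup>2)
    + 2 * a (D k) * (\<Sum>j\<in>UNIV - {k}. u $ k * ((u $ j)\<^sup>2 + (v $ j)\<^sup>2))"

definition block_q ::
  "('m::finite block_coeff \<Rightarrow> complex) \<Rightarrow> complex ^ 'm \<Rightarrow> complex ^ 'm \<Rightarrow> 'm \<Rightarrow> complex" where
  "block_q a u v k =
    a (B0 k) - a (C k) * u $ k + a (B1 k) * v $ k
    + a (D k) * v $ k * ((u $ k)\<^sup>2 + (v $ k)\<^sup>2)
    + 2 * a (D k) * (\<Sum>j\<in>UNIV - {k}. v $ k * ((u $ j)\<^sup>2 + (v $ j)\<^sup>2))"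

section \<open>Coupled resonators\<close>

text \<open>
  The type \<open>'n\<close> indexes the resonators and \<open>'c\<close> the coupling coefficients; \<open>Block i s\<close> is the
  coefficient \<open>s\<close> of the block of resonator \<open>i\<close>.
\<close>

datatype ('n, 'm, 'c) coeff = Block 'n "'m block_coeff" | Coupling 'c

text \<open>
  Substituting $X_i = \sum_k (u_{i,k} \cos(\omega_k t) + v_{i,k} \sin(\omega_k t))$ into the equations
  of motion, the term $\sum_{l \ne i} J_{i,l} X_l$ contributes $\sum_{l \ne i} J_{i,l} u_{l,k}$ to the
  cosine equation $p_{i,k}$ and $\sum_{l \ne i} J_{i,l} v_{l,k}$ to the sine equation $q_{i,k}$.
  The coordinates \<open>J i i\<close> occur in no equation; such idle coordinates do not affect generality.
\<close>

datatype 'n interaction = J 'n 'n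

definition resonator_solutions ::
  "(('n::finite, 'm::finite, 'n interaction) coeff \<Rightarrow> complex) \<Rightarrow>
    ((complex ^ 'm ^ 'n) \<times> (complex ^ 'm ^ 'n)) set" where
  "resonator_solutions x = {(u, v). \<forall>i k.
     block_p (\<lambda>s. x (Block i s)) (u $ i) (v $ i) k
       + (\<Sum>l\<in>UNIV - {i}. x (Coupling (J i l)) * u $ l $ k) = 0 \<and>
     block_q (\<lambda>s. x (Block i s)) (u $ i) (v $ i) k
       + (\<Sum>l\<in>UNIV - {i}. x (Coupling (J i l)) * v $ l $ k) = 0}"

text \<open>
  The same blocks with unrestricted linear coupling: every equation of resonator \<open>i\<close> has its own
  coefficient at every variable of every other resonator. For instance \<open>QU i k l m\<close> is the
  coefficient of $u_{l,m}$ in $q_{i,k}$. Generality in this larger coefficient space neither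
  implies nor follows formally from generality for \<open>resonator_solutions\<close>.
\<close>

datatype ('n, 'm) linear_coupling = PU 'n 'm 'n 'm | PV 'n 'm 'n 'm | QU 'n 'm 'n 'm | QV 'n 'm 'n 'm

definition linearly_coupled_solutions ::
  "(('n::finite, 'm::finite, ('n, 'm) linear_coupling) coeff \<Rightarrow> complex) \<Rightarrow>
    ((complex ^ 'm ^ 'n) \<times> (complex ^ 'm ^ 'n)) set" where
  "linearly_coupled_solutions x = {(u, v). \<forall>i k.
     block_p (\<lambda>s. x (Block i s)) (u $ i) (v $ i) k
       + (\<Sum>l\<in>UNIV - {i}. \<Sum>m\<in>UNIV.
            x (Coupling (PU i k l m)) * u $ l $ m + x (Coupling (PV i k l m)) * v $ l $ m) = 0 \<and>
     block_q (\<lambda>s. x (Block i s)) (u $ i) (v $ i) k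
       + (\<Sum>l\<in>UNIV - {i}. \<Sum>m\<in>UNIV.
            x (Coupling (QU i k l m)) * u $ l $ m + x (Coupling (QV i k l m)) * v $ l $ m) = 0}"

text \<open>Infinite sets have \<open>card\<close> 0, hence the detour through a finite subset.\<close>

definition at_least_elements :: "nat \<Rightarrow> 'a set \<Rightarrow> bool" where
  "at_least_elements n S \<longleftrightarrow> (\<exists>T\<subseteq>S. finite T \<and> card T = n)"

end

theory Submission
  imports Defs "HOL-Computational_Algebra.Fundamental_Theorem_Algebra"
begin

text \<open>
  The system has two features that make it tractable. Its constant terms enter additively, so its solution
  set is a fibre of a polynomial map of the coefficient space to itself that keeps the other coefficients
  and computes the constant terms (\<open>for_general_coupled\<close>). And its cubic terms depend on the other
  frequencies only through $S = \sum_j (u_j^2 + v_j^2)$.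

  \<^emph>\<open>At least $5^{MN}$ solutions.\<close> For special coefficients without coupling, the solutions can be written
  down. With $a_{k,1} = 1$, $b_{k,1} = -1$, $d_k = 1$ and all else zero, each frequency of each resonator
  independently has five states: zero, two signs of $u_k$, two signs of $v_k$. A parity argument shows that
  these $5^{MN}$ solutions are distinct and nondegenerate (\<open>state_inj\<close>, \<open>state_nondegenerate\<close>). They therefore
  persist on an open set of coefficients (\<open>for_general_nondegenerate\<close>). An open set is not contained in a
  proper subvariety, and the lower bound spreads from it to the complement of a hypersurface: a polynomial
  map between spaces of the same dimension with $n$ points in the fibres over a Zariski dense set has at
  least $n$ points in a general fibre (\<open>for_general_fibre\<close>). The latter is Kronecker's elimination, carried
  out with a generic linear form and a minimal annihilating polynomial, whose existence is a dimension
  count (\<open>algebraic_dependence\<close>).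

  \<^emph>\<open>At most $25$ solutions for $M = 2$, $N = 1$.\<close> In terms of $w_k = 2S - (u_k^2 + v_k^2)$ each pair of
  equations is linear in $(u_k, v_k)$. In general $(w_1,w_2)$ determines the solution, and eliminating
  $u_k$, $v_k$ leaves two quintics in $w_1$, $w_2$ with leading forms proportional to $w_1^4(2w_2 - w_1)$ and
  $w_2^4(2w_1-w_2)$ (\<open>block_quintic\<close>). These forms have no common zero besides the origin, so there are at
  most $5 \cdot 5$ common zeros (\<open>two_quintics\<close>).
\<close>

section \<open>Polynomial functions\<close>

inductive polyfun :: "(('i \<Rightarrow> complex) \<Rightarrow> complex) \<Rightarrow> bool" where
  polyfun_const: "polyfun (\<lambda>x. c)"
| polyfun_coord: "polyfun (\<lambda>x. x i)"
| polyfun_add: "polyfun f \<Longrightarrow> polyfun g \<Longrightarrow> polyfun (\<lambda>x. f x + g x)"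
| polyfun_mult: "polyfun f \<Longrightarrow> polyfun g \<Longrightarrow> polyfun (\<lambda>x. f x * g x)"

lemma polyfun_uminus: "polyfun f \<Longrightarrow> polyfun (\<lambda>x. - f x)"
  using polyfun_mult[OF polyfun_const[of "-1"]] by simp

lemma polyfun_diff: "polyfun f \<Longrightarrow> polyfun g \<Longrightarrow> polyfun (\<lambda>x. f x - g x)"
  using polyfun_add[OF _ polyfun_uminus] by fastforce

lemma polyfun_power: "polyfun f \<Longrightarrow> polyfun (\<lambda>x. f x ^ n)"
  by (induction n) (auto intro: polyfun.intros)

lemma polyfun_sum: "(\<And>a. a \<in> A \<Longrightarrow> polyfun (f a)) \<Longrightarrow> polyfun (\<lambda>x. \<Sum>a\<in>A. f a x)"
  by (induction A rule: infinite_finite_induct) (auto intro: polyfun.intros)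

lemma polyfun_prod: "(\<And>a. a \<in> A \<Longrightarrow> polyfun (f a)) \<Longrightarrow> polyfun (\<lambda>x. \<Prod>a\<in>A. f a x)"
  by (induction A rule: infinite_finite_induct) (auto intro: polyfun.intros)

lemmas polyfun_intros = polyfun.intros polyfun_uminus polyfun_diff polyfun_power polyfun_sum polyfun_prod

lemma polyfun_compose:
  assumes "polyfun f" "\<And>j. polyfun (\<lambda>z. g z j)"
  shows "polyfun (\<lambda>z. f (g z))"
  using assms(1) by induction (auto intro: polyfun.intros assms(2))

lemma polyfun_on_line:
  assumes "polyfun f"
  shows "\<exists>p. \<forall>s. f (\<lambda>i. a i + s * b i) = poly p s"
  using assms
proof induction
  case (polyfun_const c)
  show ?case by (rule exI[of _ "[:c:]"]) simp
next
  case (polyfun_coord i)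
  show ?case by (rule exI[of _ "[:a i, b i:]"]) simp
next
  case (polyfun_add f g)
  then show ?case by (metis poly_add)
next
  case (polyfun_mult f g)
  then show ?case by (metis poly_mult)
qed

text \<open>
  On the line through a non-zero of \<open>f\<close> and a non-zero of \<open>g\<close> both restrict to nonzero
  polynomials in one variable, which have finitely many zeros.
\<close>

lemma polyfun_mult_nonzero:
  assumes "polyfun f" "polyfun g" "f a \<noteq> 0" "g b \<noteq> 0"
  shows "\<exists>x. f x \<noteq> 0 \<and> g x \<noteq> 0"
proof -
  let ?l = "\<lambda>s i. a i + s * (b i - a i)"
  obtain p q where p: "\<And>s. f (?l s) = poly p s" and q: "\<And>s. g (?l s) = poly q s"
    using polyfun_on_line[OF assms(1), of a "\<lambda>i. b i - a i"]
      polyfun_on_line[OF assms(2), of a "\<lambda>i. b i - a i"] by metis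
  have "poly p 0 \<noteq> 0" "poly q 1 \<noteq> 0"
    using assms(3,4) p[of 0] q[of 1] by simp_all
  then have "p * q \<noteq> 0" by auto
  then have "finite {s. poly (p * q) s = 0}" by (rule poly_roots_finite)
  then obtain s where "s \<notin> {s. poly (p * q) s = 0}"
    using ex_new_if_finite[OF infinite_UNIV_char_0] by blast
  then have "f (?l s) \<noteq> 0 \<and> g (?l s) \<noteq> 0" using p q by auto
  then show ?thesis by (rule exI[of _ "?l s"])
qed

text \<open>
  Polynomial functions have no zero divisors, so finitely many inequations that can each be
  satisfied can be satisfied together.
\<close>

lemma polyfun_prod_nonzero:
  assumes "finite A" "\<And>a. a \<in> A \<Longrightarrow> polyfun (f a)" "\<And>a. a \<in> A \<Longrightarrow> \<exists>x. f a x \<noteq> 0"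
  shows "\<exists>x. (\<Prod>a\<in>A. f a x) \<noteq> 0"
  using assms
proof (induction A)
  case (insert a A)
  then obtain y z where "f a y \<noteq> 0" "(\<Prod>a\<in>A. f a z) \<noteq> 0" by (metis insertCI)
  then have "\<exists>x. f a x \<noteq> 0 \<and> (\<Prod>a\<in>A. f a x) \<noteq> 0"
    using insert by (intro polyfun_mult_nonzero polyfun_prod) auto
  then show ?case using insert by auto
qed simp

section \<open>Generality\<close>

text \<open>
  Formal polynomials and polynomial functions are matched here once and for all; afterwards only
  functions occur, on which evaluation, restriction to lines and substitution are immediate.
\<close>

definition monomial_value :: "('i \<Rightarrow>\<^sub>0 nat) \<Rightarrow> ('i \<Rightarrow> complex) \<Rightarrow> complex" where
  "monomial_value e x = (\<Prod>i\<in>Poly_Mapping.keys e. x i ^ Poly_Mapping.lookup e i)"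

lemma monomial_value_eq:
  assumes "finite A" "Poly_Mapping.keys e \<subseteq> A"
  shows "monomial_value e x = (\<Prod>i\<in>A. x i ^ Poly_Mapping.lookup e i)"
  unfolding monomial_value_def
  by (rule prod.mono_neutral_left) (use assms in \<open>auto simp: in_keys_iff\<close>)

lemma monomial_value_plus:
  "monomial_value (e + e') x = monomial_value e x * monomial_value e' x"
proof -
  let ?A = "Poly_Mapping.keys e \<union> Poly_Mapping.keys e'"
  have "Poly_Mapping.keys (e + e') \<subseteq> ?A" by (rule Poly_Mapping.keys_add)
  then show ?thesis
    by (subst (1 2 3) monomial_value_eq[of ?A]) (auto simp: lookup_add power_add prod.distrib)
qed

lemma poly_value_eq:
  assumes "finite E" "Poly_Mapping.keys P \<subseteq> E"
  shows "poly_value P x = (\<Sum>e\<in>E. Poly_Mapping.lookup P e * monomial_value e x)"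
  unfolding poly_value_def monomial_value_def
  by (rule sum.mono_neutral_left) (use assms in \<open>auto simp: in_keys_iff\<close>)

lemma poly_value_plus: "poly_value (P + Q) x = poly_value P x + poly_value Q x"
proof -
  let ?E = "Poly_Mapping.keys P \<union> Poly_Mapping.keys Q"
  have "Poly_Mapping.keys (P + Q) \<subseteq> ?E" by (rule Poly_Mapping.keys_add)
  then show ?thesis
    by (subst (1 2 3) poly_value_eq[of ?E]) (auto simp: lookup_add algebra_simps sum.distrib)
qed

lemma poly_value_sum: "poly_value (\<Sum>a\<in>A. P a) x = (\<Sum>a\<in>A. poly_value (P a) x)"
proof (induction A rule: infinite_finite_induct)
  case empty
  show ?case by (simp add: poly_value_def)
next
  case (infinite A)
  then show ?case by (simp add: poly_value_def)
qed (simp add: poly_value_plus)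

lemma poly_value_single: "poly_value (Poly_Mapping.single e c) x = c * monomial_value e x"
  by (subst poly_value_eq[of "{e}"]) auto

lemma polyfun_imp_poly_value:
  assumes "polyfun f"
  shows "\<exists>P. \<forall>x. f x = poly_value P x"
  using assms
proof induction
  case (polyfun_const c)
  show ?case
    by (rule exI[of _ "Poly_Mapping.single 0 c"]) (simp add: poly_value_single monomial_value_def)
next
  case (polyfun_coord i)
  show ?case
    by (rule exI[of _ "Poly_Mapping.single (Poly_Mapping.single i 1) 1"])
      (simp add: poly_value_single monomial_value_def)
next
  case (polyfun_add f g)
  then show ?case by (metis poly_value_plus)
next
  case (polyfun_mult f g)
  then obtain P Q where "\<And>x. f x = poly_value P x" "\<And>x. g x = poly_value Q x" by blast
  then have "f x * g x = poly_value (\<Sum>e\<in>Poly_Mapping.keys P. \<Sum>e'\<in>Poly_Mapping.keys Q.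
      Poly_Mapping.single (e + e') (Poly_Mapping.lookup P e * Poly_Mapping.lookup Q e')) x" for x
    unfolding poly_value_sum poly_value_single monomial_value_plus
    by (simp add: poly_value_eq[OF finite_keys subset_refl] sum_product mult_ac)
  then show ?case by blast
qed

lemma polyfun_poly_value: "polyfun (poly_value P)"
  unfolding poly_value_def by (intro polyfun_intros)

text \<open>
  A proper algebraic subvariety may as well be a hypersurface: one of its equations is not
  identically zero.
\<close>

lemma for_general_iff:
  "for_general Q \<longleftrightarrow> (\<exists>f. polyfun f \<and> (\<exists>x. f x \<noteq> 0) \<and> (\<forall>x. f x \<noteq> 0 \<longrightarrow> Q x))"
proof
  assume "for_general Q"
  then obtain S x where "\<And>y. (\<exists>P\<in>S. poly_value P y \<noteq> 0) \<Longrightarrow> Q y" "\<exists>P\<in>S. poly_value P x \<noteq> 0"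
    unfolding for_general_def algebraic_subvariety_def by blast
  then show "\<exists>f. polyfun f \<and> (\<exists>x. f x \<noteq> 0) \<and> (\<forall>x. f x \<noteq> 0 \<longrightarrow> Q x)"
    using polyfun_poly_value by metis
next
  assume "\<exists>f. polyfun f \<and> (\<exists>x. f x \<noteq> 0) \<and> (\<forall>x. f x \<noteq> 0 \<longrightarrow> Q x)"
  then obtain P x where "poly_value P x \<noteq> 0" "\<And>y. poly_value P y \<noteq> 0 \<Longrightarrow> Q y"
    using polyfun_imp_poly_value by metis
  then show "for_general Q"
    unfolding for_general_def algebraic_subvariety_def
    by (intro exI[of _ "{x. poly_value P x = 0}"]) (auto intro!: exI[of _ "{P}"])
qed

lemma for_general_conj:
  assumes "for_general P" "for_general Q"
  shows "for_general (\<lambda>x. P x \<and> Q x)"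
proof -
  obtain f g a b where "polyfun f" "f a \<noteq> 0" "\<And>x. f x \<noteq> 0 \<Longrightarrow> P x"
      "polyfun g" "g b \<noteq> 0" "\<And>x. g x \<noteq> 0 \<Longrightarrow> Q x"
    using assms unfolding for_general_iff by metis
  then show ?thesis
    using polyfun_mult_nonzero[of f g a b] polyfun_mult[of f g]
    unfolding for_general_iff by (intro exI[of _ "\<lambda>x. f x * g x"]) auto
qed

lemma for_general_mono: "for_general P \<Longrightarrow> (\<And>x. P x \<Longrightarrow> Q x) \<Longrightarrow> for_general Q"
  unfolding for_general_iff by blast

section \<open>Algebraic dependence\<close>

text \<open>
  Gaussian elimination of one equation and one unknown. The lemma is the source of both dimension
  counts below: the annihilating polynomial, and the bound $25$.
\<close>

lemma underdetermined_system:
  fixes M :: "'a \<Rightarrow> 'b \<Rightarrow> 'c::field"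
  assumes "finite A" "finite B" "card A < card B"
  shows "\<exists>x. (\<exists>b\<in>B. x b \<noteq> 0) \<and> (\<forall>a\<in>A. (\<Sum>b\<in>B. M a b * x b) = 0)"
  using assms
proof (induction A arbitrary: B M rule: finite_induct)
  case empty
  then have "B \<noteq> {}" by auto
  then show ?case by (intro exI[of _ "\<lambda>_. 1"]) auto
next
  case (insert a A)
  show ?case
  proof (cases "\<forall>b\<in>B. M a b = 0")
    case True
    have "card A < card B" using insert by simp
    from insert.IH[OF insert.prems(1) this, of M] True show ?thesis by auto
  next
    case False
    then obtain b0 where b0: "b0 \<in> B" "M a b0 \<noteq> 0" by blast
    define B' where "B' = B - {b0}"
    have fin: "finite B'" and card: "card A < card B'"
      using insert b0 by (auto simp: B'_def)
    have sum_B: "(\<Sum>b\<in>B. h b) = h b0 + (\<Sum>b\<in>B'. h b)" for h :: "'b \<Rightarrow> 'c"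
      unfolding B'_def using insert.prems(1) b0(1) by (rule sum.remove)
    obtain x where x: "\<exists>b\<in>B'. x b \<noteq> 0"
        "\<And>a'. a' \<in> A \<Longrightarrow> (\<Sum>b\<in>B'. (M a' b - M a' b0 / M a b0 * M a b) * x b) = 0"
      using insert.IH[OF fin card, of "\<lambda>a' b. M a' b - M a' b0 / M a b0 * M a b"] by blast
    define y where "y = x(b0 := - (\<Sum>b\<in>B'. M a b * x b) / M a b0)"
    have y_B': "(\<Sum>b\<in>B'. m b * y b) = (\<Sum>b\<in>B'. m b * x b)" for m :: "'b \<Rightarrow> 'c"
      by (rule sum.cong) (auto simp: y_def B'_def)
    have "(\<Sum>b\<in>B. M a b * y b) = 0"
      unfolding sum_B y_B' using b0(2) by (simp add: y_def)
    moreover have "(\<Sum>b\<in>B. M a' b * y b) = 0" if "a' \<in> A" for a'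
    proof -
      have "(\<Sum>b\<in>B'. M a' b * x b) - M a' b0 / M a b0 * (\<Sum>b\<in>B'. M a b * x b) = 0"
        using x(2)[OF that] by (simp add: algebra_simps sum_subtractf sum_distrib_left)
      then show ?thesis unfolding sum_B y_B' by (simp add: y_def)
    qed
    moreover have "\<exists>b\<in>B. y b \<noteq> 0"
      using x(1) by (auto simp: y_def B'_def)
    ultimately show ?thesis by blast
  qed
qed

definition exponents_upto :: "nat \<Rightarrow> ('i::finite \<Rightarrow> nat) set" where
  "exponents_upto n = {e. \<forall>i. e i \<le> n}"

definition mon :: "('i::finite \<Rightarrow> nat) \<Rightarrow> ('i \<Rightarrow> complex) \<Rightarrow> complex" where
  "mon e x = (\<Prod>i\<in>UNIV. x i ^ e i)"

lemma exponents_upto_PiE: "exponents_upto n = Pi\<^sub>E UNIV (\<lambda>_. {..n})"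
  by (auto simp: exponents_upto_def PiE_def Pi_def)

lemma finite_exponents_upto [simp]: "finite (exponents_upto n)"
  unfolding exponents_upto_PiE by (intro finite_PiE) auto

lemma in_exponents_upto: "e \<in> exponents_upto n \<longleftrightarrow> (\<forall>i. e i \<le> n)"
  by (simp add: exponents_upto_def)

lemma card_exponents_upto: "card (exponents_upto n :: ('i::finite \<Rightarrow> nat) set) = Suc n ^ CARD('i)"
  unfolding exponents_upto_PiE by (simp add: card_PiE)

lemma mon_plus: "mon (\<lambda>i. e i + e' i) x = mon e x * mon e' x"
  by (simp add: mon_def power_add prod.distrib)

lemma polyfun_mon: "polyfun (mon e)"
  unfolding mon_def[abs_def] by (intro polyfun_intros)

text \<open>
  Boxes of exponents suit counting better than total degrees: their size is a plain power.
\<close>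

definition boxed :: "nat \<Rightarrow> (('i::finite \<Rightarrow> complex) \<Rightarrow> complex) \<Rightarrow> bool" where
  "boxed n f \<longleftrightarrow> (\<exists>c. \<forall>x. f x = (\<Sum>e\<in>exponents_upto n. c e * mon e x))"

lemma boxed_mono:
  assumes "boxed n f" "n \<le> m"
  shows "boxed m f"
proof -
  obtain c where c: "\<And>x. f x = (\<Sum>e\<in>exponents_upto n. c e * mon e x)"
    using assms(1) unfolding boxed_def by blast
  have "exponents_upto n \<subseteq> (exponents_upto m :: ('a \<Rightarrow> nat) set)"
    using assms(2) by (simp add: subset_iff in_exponents_upto) (meson le_trans)
  then have "f x = (\<Sum>e\<in>exponents_upto m. (if e \<in> exponents_upto n then c e else 0) * mon e x)" for x
    unfolding c by (intro sum.mono_neutral_cong_left) auto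
  then show ?thesis unfolding boxed_def by (intro exI[of _ "\<lambda>e. if e \<in> exponents_upto n then c e else 0"]) simp
qed

lemma boxed_mon:
  assumes "e \<in> exponents_upto n"
  shows "boxed n (\<lambda>x. c * mon e x)"
proof -
  have "c * mon e x = (\<Sum>e'\<in>exponents_upto n. (if e' = e then c else 0) * mon e' x)" for x
    using assms by (subst sum.remove[of _ e]) auto
  then show ?thesis unfolding boxed_def by (intro exI[of _ "\<lambda>e'. if e' = e then c else 0"]) simp
qed

lemma boxed_add:
  assumes "boxed n f" "boxed n g"
  shows "boxed n (\<lambda>x. f x + g x)"
proof -
  obtain c d where "\<And>x. f x = (\<Sum>e\<in>exponents_upto n. c e * mon e x)"
      "\<And>x. g x = (\<Sum>e\<in>exponents_upto n. d e * mon e x)"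
    using assms unfolding boxed_def by blast
  then show ?thesis
    unfolding boxed_def by (intro exI[of _ "\<lambda>e. c e + d e"]) (simp add: sum.distrib distrib_right)
qed

lemma boxed_mult:
  assumes "boxed n f" "boxed m g"
  shows "boxed (n + m) (\<lambda>x. f x * g x)"
proof -
  obtain c d where cd: "\<And>x. f x = (\<Sum>e\<in>exponents_upto n. c e * mon e x)"
      "\<And>x. g x = (\<Sum>e\<in>exponents_upto m. d e * mon e x)"
    using assms unfolding boxed_def by blast
  let ?S = "exponents_upto n \<times> (exponents_upto m :: ('a \<Rightarrow> nat) set)"
  let ?h = "\<lambda>(e, e'). (\<lambda>i. e i + e' i :: nat)"
  have "f x * g x = (\<Sum>e\<in>exponents_upto (n + m). (\<Sum>p\<in>{p\<in>?S. ?h p = e}. c (fst p) * d (snd p)) * mon e x)"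
    for x
  proof -
    have "f x * g x = (\<Sum>p\<in>?S. c (fst p) * d (snd p) * mon (?h p) x)"
      unfolding cd sum_product sum.cartesian_product
      by (rule sum.cong) (auto simp: mon_plus)
    also have "\<dots> = (\<Sum>e\<in>exponents_upto (n + m). \<Sum>p\<in>{p\<in>?S. ?h p = e}. c (fst p) * d (snd p) * mon (?h p) x)"
      by (rule sum.group[symmetric]) (auto simp: in_exponents_upto add_mono)
    finally show ?thesis by (simp add: sum_distrib_right)
  qed
  then show ?thesis
    unfolding boxed_def
    by (intro exI[of _ "\<lambda>e. \<Sum>p\<in>{p\<in>?S. ?h p = e}. c (fst p) * d (snd p)"]) blast
qed

lemma boxed_const: "boxed n (\<lambda>x. c)"
  using boxed_mon[of "\<lambda>_. 0" n c] by (simp add: exponents_upto_def mon_def)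

lemma boxed_power: "boxed n f \<Longrightarrow> boxed (k * n) (\<lambda>x. f x ^ k)"
  by (induction k) (auto simp: boxed_const intro: boxed_mult)

lemma boxed_prod:
  "(\<And>a. a \<in> A \<Longrightarrow> boxed n (f a)) \<Longrightarrow> boxed (card A * n) (\<lambda>x. \<Prod>a\<in>A. f a x)"
  by (induction A rule: infinite_finite_induct) (auto simp: boxed_const intro: boxed_mult)

lemma polyfun_boxed:
  assumes "polyfun f"
  shows "\<exists>n. boxed n f"
  using assms
proof induction
  case (polyfun_const c)
  then show ?case using boxed_const by blast
next
  case (polyfun_coord i)
  have "mon (\<lambda>j. if j = i then 1 else 0) x = x i" for x
    unfolding mon_def by (subst prod.remove[of _ i]) auto
  then have "boxed 1 (\<lambda>x. x i)"
    using boxed_mon[of "\<lambda>j. if j = i then 1 else 0" 1 1] by (simp add: in_exponents_upto)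
  then show ?case by blast
next
  case (polyfun_add f g)
  then obtain n m where "boxed n f" "boxed m g" by blast
  then have "boxed (max n m) f" "boxed (max n m) g" by (auto intro: boxed_mono)
  then show ?case using boxed_add by blast
next
  case (polyfun_mult f g)
  then show ?case using boxed_mult by blast
qed

text \<open>
  By induction on the set of variables: for fixed values of the others, the sum is a polynomial in
  one variable that vanishes identically, hence each of its coefficients does. The induction has to
  speak of families \<open>S\<close> of exponents that are determined by their values on \<open>I\<close>, since collecting the
  terms with a fixed exponent of one variable leaves exponents on the others.
\<close>

lemma monomials_independent:
  fixes c :: "('i \<Rightarrow> nat) \<Rightarrow> complex"
  assumes "finite I" "finite S" "\<And>e e'. e \<in> S \<Longrightarrow> e' \<in> S \<Longrightarrow> (\<And>i. i \<in> I \<Longrightarrow> e i = e' i) \<Longrightarrow> e = e'"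
    and "\<And>x. (\<Sum>e\<in>S. c e * (\<Prod>i\<in>I. x i ^ e i)) = 0" "e \<in> S"
  shows "c e = 0"
  using assms
proof (induction I arbitrary: S e rule: finite_induct)
  case empty
  then have "S = {e}" by auto
  then show ?case using empty.prems(3) by simp
next
  case (insert j I)
  let ?S = "{e' \<in> S. e' j = e j}"
  have "(\<Sum>e'\<in>?S. c e' * (\<Prod>i\<in>I. x i ^ e' i)) = 0" for x
  proof -
    define p where "p = (\<Sum>e'\<in>S. monom (c e' * (\<Prod>i\<in>I. x i ^ e' i)) (e' j))"
    have "poly p s = (\<Sum>e'\<in>S. c e' * (\<Prod>i\<in>insert j I. (x(j := s)) i ^ e' i))" for s
    proof -
      have "(\<Prod>i\<in>I. (x(j := s)) i ^ e' i) = (\<Prod>i\<in>I. x i ^ e' i)" for e'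
        by (rule prod.cong) (use insert.hyps in auto)
      then show ?thesis
        using insert.hyps by (simp add: p_def poly_sum poly_monom mult_ac)
    qed
    then have "\<forall>s. poly p s = 0" using insert.prems(3) by simp
    then have "p = 0" by (simp add: poly_all_0_iff_0)
    then have "coeff p (e j) = 0" by simp
    then show ?thesis
      by (simp add: p_def coeff_sum sum.inter_filter[OF insert.prems(1), symmetric] if_distrib
          cong: if_cong)
  qed
  moreover have "e' = e''" if "e' \<in> ?S" "e'' \<in> ?S" "\<And>i. i \<in> I \<Longrightarrow> e' i = e'' i" for e' e''
    using that by (intro insert.prems(2)) auto
  ultimately show ?case
    using insert.prems by (intro insert.IH[of ?S]) auto
qed

lemma mon_independent:
  assumes "\<And>x. (\<Sum>e\<in>exponents_upto n. c e * mon e x) = 0" "e \<in> exponents_upto n"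
  shows "c e = 0"
  by (rule monomials_independent[of UNIV "exponents_upto n" c]) (use assms in \<open>auto simp: mon_def\<close>)

text \<open>
  More functions than variables are algebraically dependent. With $r$ variables and $r+1$ functions
  there are $(n+1)^{r+1}$ products of powers with exponents up to $n$, and they lie in a space of
  dimension $(kn+1)^r$ with $k$ independent of $n$. For large $n$ the first number wins.
\<close>

lemma algebraic_dependence:
  fixes g :: "'j::finite \<Rightarrow> ('j \<Rightarrow> complex) \<Rightarrow> complex"
  assumes "\<And>j. polyfun (g j)" "polyfun g0"
  shows "\<exists>n c. (\<exists>b\<in>exponents_upto n \<times> {..n}. c b \<noteq> 0) \<and>
    (\<forall>z. (\<Sum>b\<in>exponents_upto n \<times> {..n}. c b * (mon (fst b) (\<lambda>j. g j z) * g0 z ^ snd b)) = 0)"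
proof -
  obtain m0 where m0: "boxed m0 g0" using polyfun_boxed[OF assms(2)] by blast
  obtain m where m: "\<And>j. boxed (m j) (g j)" using polyfun_boxed[OF assms(1)] by metis
  define d where "d = m0 + (\<Sum>j\<in>UNIV. m j)"
  have d: "boxed d g0" "boxed d (g j)" for j
    by (auto intro!: boxed_mono[OF m0] boxed_mono[OF m] trans_le_add2[OF member_le_sum] simp: d_def)
  let ?r = "CARD('j)"
  define k where "k = (?r + 1) * d"
  \<comment> \<open>This choice gives $(kn+1)^r \<le> (k+1)^r (n+1)^r = n (n+1)^r < (n+1)^{r+1}$.\<close>
  define n where "n = (k + 1) ^ ?r"
  let ?B = "exponents_upto n \<times> {..n} :: (('j \<Rightarrow> nat) \<times> nat) set"
  have "boxed (k * n) (\<lambda>z. mon (fst b) (\<lambda>j. g j z) * g0 z ^ snd b)" if "b \<in> ?B" for b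
  proof -
    have "boxed (n * d) (\<lambda>z. g j z ^ fst b j)" for j
      by (rule boxed_mono[OF boxed_power[OF d(2)]])
        (use that in \<open>auto simp: exponents_upto_def\<close>)
    then have "boxed (?r * (n * d)) (\<lambda>z. mon (fst b) (\<lambda>j. g j z))"
      unfolding mon_def by (rule boxed_prod)
    moreover have "boxed (n * d) (\<lambda>z. g0 z ^ snd b)"
      by (rule boxed_mono[OF boxed_power[OF d(1)]]) (use that in auto)
    ultimately have "boxed (?r * (n * d) + n * d) (\<lambda>z. mon (fst b) (\<lambda>j. g j z) * g0 z ^ snd b)"
      by (rule boxed_mult)
    then show ?thesis by (simp add: k_def algebra_simps)
  qed
  then have "\<forall>b\<in>?B. \<exists>h. \<forall>z. mon (fst b) (\<lambda>j. g j z) * g0 z ^ snd b =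
      (\<Sum>e\<in>exponents_upto (k * n). h e * mon e z)"
    unfolding boxed_def by blast
  then obtain h where h: "\<forall>b\<in>?B. \<forall>z. mon (fst b) (\<lambda>j. g j z) * g0 z ^ snd b =
      (\<Sum>e\<in>exponents_upto (k * n). h b e * mon e z)"
    by (rule bchoice[THEN exE])
  have "card (exponents_upto (k * n) :: ('j \<Rightarrow> nat) set) = Suc (k * n) ^ ?r"
    by (rule card_exponents_upto)
  also have "\<dots> \<le> ((k + 1) * Suc n) ^ ?r" by (rule power_mono) auto
  also have "\<dots> = n * Suc n ^ ?r" by (simp only: n_def power_mult_distrib)
  also have "\<dots> < Suc n * Suc n ^ ?r" by (intro mult_strict_right_mono) auto
  also have "\<dots> = card ?B" by (simp add: card_cartesian_product card_exponents_upto)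
  finally have "\<exists>c. (\<exists>b\<in>?B. c b \<noteq> 0) \<and> (\<forall>e\<in>exponents_upto (k * n). (\<Sum>b\<in>?B. h b e * c b) = 0)"
    by (intro underdetermined_system) auto
  then obtain c where c: "\<exists>b\<in>?B. c b \<noteq> 0"
      "\<And>e. e \<in> exponents_upto (k * n) \<Longrightarrow> (\<Sum>b\<in>?B. h b e * c b) = 0"
    by blast
  have "(\<Sum>b\<in>?B. c b * (mon (fst b) (\<lambda>j. g j z) * g0 z ^ snd b)) = 0" for z
  proof -
    have "(\<Sum>b\<in>?B. c b * (mon (fst b) (\<lambda>j. g j z) * g0 z ^ snd b)) =
        (\<Sum>b\<in>?B. \<Sum>e\<in>exponents_upto (k * n). c b * (h b e * mon e z))"
      by (rule sum.cong) (simp_all add: h sum_distrib_left)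
    also have "\<dots> = (\<Sum>e\<in>exponents_upto (k * n). (\<Sum>b\<in>?B. h b e * c b) * mon e z)"
      by (subst sum.swap) (simp add: sum_distrib_left sum_distrib_right mult_ac)
    also have "\<dots> = 0" using c(2) by simp
    finally show ?thesis .
  qed
  with c(1) show ?thesis by blast
qed

section \<open>Univariate polynomials over the ring of polynomial functions\<close>

text \<open>
  As a type, the polynomial functions form an integral domain, so that polynomials in one further
  variable over them come with degree, leading coefficient and pseudo-division.
\<close>

typedef 'i pfun = "{f :: ('i \<Rightarrow> complex) \<Rightarrow> complex. polyfun f}"
  morphisms ev Pfun
  using polyfun_const by blast

setup_lifting type_definition_pfun

lemma polyfun_ev: "polyfun (ev a)"
  using ev[of a] by simp

instantiation pfun :: (type) idom
begin

lift_definition zero_pfun :: "'a pfun" is "\<lambda>_. 0" by (intro polyfun_intros)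
lift_definition one_pfun :: "'a pfun" is "\<lambda>_. 1" by (intro polyfun_intros)
lift_definition plus_pfun :: "'a pfun \<Rightarrow> 'a pfun \<Rightarrow> 'a pfun" is "\<lambda>f g x. f x + g x"
  by (intro polyfun_intros)
lift_definition minus_pfun :: "'a pfun \<Rightarrow> 'a pfun \<Rightarrow> 'a pfun" is "\<lambda>f g x. f x - g x"
  by (intro polyfun_intros)
lift_definition uminus_pfun :: "'a pfun \<Rightarrow> 'a pfun" is "\<lambda>f x. - f x"
  by (intro polyfun_intros)
lift_definition times_pfun :: "'a pfun \<Rightarrow> 'a pfun \<Rightarrow> 'a pfun" is "\<lambda>f g x. f x * g x"
  by (intro polyfun_intros)

instance
proof
  fix a b :: "'a pfun"
  assume "a \<noteq> 0" "b \<noteq> 0"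
  then show "a * b \<noteq> 0"
    using polyfun_mult_nonzero[OF polyfun_ev polyfun_ev, of a _ b]
    by (auto simp: fun_eq_iff times_pfun.rep_eq zero_pfun.rep_eq simp flip: ev_inject)
qed (transfer; auto simp: algebra_simps fun_eq_iff)+

end

lemmas ev_simps [simp] = zero_pfun.rep_eq one_pfun.rep_eq plus_pfun.rep_eq minus_pfun.rep_eq
  uminus_pfun.rep_eq times_pfun.rep_eq

lemma pfun_eq_iff: "a = b \<longleftrightarrow> (\<forall>x. ev a x = ev b x)"
  by (metis ev_inject ext)

lemma pfun_nonzero_iff: "a \<noteq> 0 \<longleftrightarrow> (\<exists>x. ev a x \<noteq> 0)"
  by (simp add: pfun_eq_iff)

lemma ev_of_nat [simp]: "ev (of_nat n) x = of_nat n"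
  by (induction n) auto

lemma ev_power [simp]: "ev (a ^ n) x = ev a x ^ n"
  by (induction n) auto

instance pfun :: (type) ring_char_0
  by standard (metis ev_of_nat injI of_nat_eq_iff)

text \<open>
  \<open>pval R y T\<close> specializes the coefficients at \<open>y\<close> and the variable at \<open>T\<close>.
\<close>

definition pval :: "'i pfun poly \<Rightarrow> ('i \<Rightarrow> complex) \<Rightarrow> complex \<Rightarrow> complex" where
  "pval R y T = poly (map_poly (\<lambda>a. ev a y) R) T"

lemma pval_0 [simp]: "pval 0 y T = 0"
  by (simp add: pval_def)

lemma pval_pCons [simp]: "pval (pCons a R) y T = ev a y + T * pval R y T"
  by (simp add: pval_def map_poly_pCons)

lemma pval_add [simp]: "pval (P + Q) y T = pval P y T + pval Q y T"
  by (induction P Q rule: poly_induct2) (auto simp: algebra_simps)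

lemma pval_uminus [simp]: "pval (- P) y T = - pval P y T"
  by (induction P) auto

lemma pval_diff [simp]: "pval (P - Q) y T = pval P y T - pval Q y T"
  using pval_add[of P "- Q" y T] by simp

lemma pval_smult [simp]: "pval (smult a P) y T = ev a y * pval P y T"
  by (induction P) (auto simp: algebra_simps)

lemma pval_mult [simp]: "pval (P * Q) y T = pval P y T * pval Q y T"
  by (induction P) (auto simp: algebra_simps)

lemma pval_sum: "pval (\<Sum>a\<in>A. P a) y T = (\<Sum>a\<in>A. pval (P a) y T)"
  by (induction A rule: infinite_finite_induct) auto

lemma pval_monom [simp]: "pval (monom a n) y T = ev a y * T ^ n"
  by (induction n) (auto simp: monom_0 monom_Suc)

lemma polyfun_pval:
  assumes "\<And>j. polyfun (\<lambda>z. g z j)" "polyfun g0"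
  shows "polyfun (\<lambda>z. pval R (g z) (g0 z))"
  by (induction R) (auto intro!: polyfun_intros polyfun_compose[OF polyfun_ev] assms)

lemma pval_pderiv: "pval (pderiv R) y T = poly (pderiv (map_poly (\<lambda>a. ev a y) R)) T"
proof -
  have "map_poly (\<lambda>a. ev a y) (pderiv R) = pderiv (map_poly (\<lambda>a. ev a y) R)"
    by (rule poly_eqI) (simp add: coeff_pderiv coeff_map_poly algebra_simps)
  then show ?thesis by (simp add: pval_def)
qed

lemma annihilating_poly:
  fixes g :: "'j::finite \<Rightarrow> ('j \<Rightarrow> complex) \<Rightarrow> complex"
  assumes "\<And>j. polyfun (g j)" "polyfun g0"
  shows "\<exists>R. R \<noteq> 0 \<and> (\<forall>z. pval R (\<lambda>j. g j z) (g0 z) = 0)"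
proof -
  obtain n and c :: "('j \<Rightarrow> nat) \<times> nat \<Rightarrow> complex" and e k where ek: "e \<in> exponents_upto n" "k \<le> n" "c (e, k) \<noteq> 0"
    and c: "\<And>z. (\<Sum>b\<in>exponents_upto n \<times> {..n}. c b * (mon (fst b) (\<lambda>j. g j z) * g0 z ^ snd b)) = 0"
    using algebraic_dependence[of g g0] assms by auto
  define a where "a k = Pfun (\<lambda>y. \<Sum>e\<in>exponents_upto n. c (e, k) * mon e y)" for k
  have ev_a: "ev (a k) y = (\<Sum>e\<in>exponents_upto n. c (e, k) * mon e y)" for k y
    unfolding a_def by (subst Pfun_inverse) (auto intro!: polyfun_intros polyfun_mon)
  define R where "R = (\<Sum>k\<le>n. monom (a k) k)"
  have "coeff R k = a k" using ek(2) by (simp add: R_def coeff_sum)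
  moreover have "a k \<noteq> 0"
    using mon_independent[of "\<lambda>e. c (e, k)" n e] ek by (auto simp: pfun_eq_iff ev_a)
  ultimately have "R \<noteq> 0" by auto
  moreover have "pval R (\<lambda>j. g j z) (g0 z) = 0" for z
  proof -
    have "pval R (\<lambda>j. g j z) (g0 z) =
        (\<Sum>k\<le>n. \<Sum>e\<in>exponents_upto n. c (e, k) * (mon e (\<lambda>j. g j z) * g0 z ^ k))"
      by (simp add: R_def pval_sum ev_a sum_distrib_left sum_distrib_right mult_ac)
    also have "\<dots> = 0"
      using c[of z] by (subst sum.swap) (simp add: sum.cartesian_product case_prod_beta)
    finally show ?thesis .
  qed
  ultimately show ?thesis by blast
qed

section \<open>The number of points in a general fibre\<close>

lemma at_least_elementsI:
  assumes "finite A" "n \<le> card A" "inj_on h A" "h ` A \<subseteq> S"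
  shows "at_least_elements n S"
proof -
  obtain B where "B \<subseteq> A" "card B = n" "finite B"
    using obtain_subset_with_card_n[OF assms(2)] by blast
  then show ?thesis
    unfolding at_least_elements_def
    by (intro exI[of _ "h ` B"]) (use assms in \<open>auto simp: card_image inj_on_subset\<close>)
qed

lemma at_least_elements_image:
  assumes "at_least_elements n S" "inj_on h S" "h ` S \<subseteq> S'"
  shows "at_least_elements n S'"
proof -
  obtain T where "T \<subseteq> S" "finite T" "card T = n"
    using assms(1) unfolding at_least_elements_def by blast
  then show ?thesis using assms(2,3) by (intro at_least_elementsI[of T n h]) (auto intro: inj_on_subset)
qed

text \<open>
  Partial derivatives are needed as polynomial functions, not just as numbers, because they become
  coefficients again.
\<close>

lemma polyfun_partial_derivative:
  assumes "polyfun f"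
  shows "\<exists>f'. polyfun f' \<and> (\<forall>x. ((\<lambda>s. f (x(j := x j + s))) has_field_derivative f' x) (at 0))"
  using assms
proof induction
  case (polyfun_const c)
  show ?case by (intro exI[of _ "\<lambda>_. 0"]) (auto intro: polyfun_intros)
next
  case (polyfun_coord i)
  show ?case
    by (intro exI[of _ "\<lambda>_. if i = j then 1 else 0"])
      (auto intro!: polyfun_intros derivative_eq_intros)
next
  case (polyfun_add f g)
  then obtain f' g' where "polyfun f'" "polyfun g'"
      "\<And>x. ((\<lambda>s. f (x(j := x j + s))) has_field_derivative f' x) (at 0)"
      "\<And>x. ((\<lambda>s. g (x(j := x j + s))) has_field_derivative g' x) (at 0)"
    by blast
  then show ?case
    by (intro exI[of _ "\<lambda>x. f' x + g' x"]) (auto intro!: polyfun_intros DERIV_add simp del: fun_upd_apply)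
next
  case (polyfun_mult f g)
  then obtain f' g' where "polyfun f'" "polyfun g'"
      "\<And>x. ((\<lambda>s. f (x(j := x j + s))) has_field_derivative f' x) (at 0)"
      "\<And>x. ((\<lambda>s. g (x(j := x j + s))) has_field_derivative g' x) (at 0)"
    by blast
  then show ?case using polyfun_mult.hyps
    by (intro exI[of _ "\<lambda>x. f' x * g x + g' x * f x"])
      (auto intro!: polyfun_intros derivative_eq_intros simp del: fun_upd_apply)
qed

lemma pval_partial_derivative:
  "\<exists>Q. \<forall>y T w. ((\<lambda>s. pval R (y(j := y j + s)) (T + s * w)) has_field_derivative
      pval Q y T + w * pval (pderiv R) y T) (at 0)"
proof (induction R)
  case 0
  show ?case by (intro exI[of _ 0]) simp
next
  case (pCons a R)
  then obtain Q where Q: "\<And>y T w. ((\<lambda>s. pval R (y(j := y j + s)) (T + s * w)) has_field_derivative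
      pval Q y T + w * pval (pderiv R) y T) (at 0)" by blast
  obtain f' where f': "polyfun f'"
      "\<And>x. ((\<lambda>s. ev a (x(j := x j + s))) has_field_derivative f' x) (at 0)"
    using polyfun_partial_derivative[OF polyfun_ev, of a j] by blast
  then have ev: "ev (Pfun f') = f'" by (simp add: Pfun_inverse)
  have "((\<lambda>s. ev a (y(j := y j + s)) + (T + s * w) * pval R (y(j := y j + s)) (T + s * w))
      has_field_derivative f' y + (w * pval R y T + T * (pval Q y T + w * pval (pderiv R) y T))) (at 0)"
    for y T w
    by (rule derivative_eq_intros f' Q refl | simp)+
  then show ?case
    by (intro exI[of _ "pCons (Pfun f') Q"]) (simp add: ev pderiv_pCons algebra_simps del: fun_upd_apply)
qed

text \<open>
  Elimination for a dominant map \<open>\<Psi>\<close> between spaces of equal dimension and a function \<open>g\<close> on the source.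
  The polynomials \<open>Q\<close> with \<open>Q(\<Psi>(z), g(z)) = 0\<close> for all \<open>z\<close> form a prime ideal, and \<open>R\<close> is a nonzero
  element of least degree. It plays the role of the minimal polynomial of \<open>g\<close> over the field of rational
  functions in \<open>\<Psi>\<close>, but stays free of denominators and can be specialized.
\<close>

locale minimal_annihilator =
  fixes \<Psi> :: "('j \<Rightarrow> complex) \<Rightarrow> 'j \<Rightarrow> complex" and g :: "('j \<Rightarrow> complex) \<Rightarrow> complex"
    and R :: "'j pfun poly"
  assumes polyfun_\<Psi>: "\<And>j. polyfun (\<lambda>z. \<Psi> z j)" and polyfun_g: "polyfun g"
    and dominant: "\<And>a. a \<noteq> 0 \<Longrightarrow> \<exists>z. ev a (\<Psi> z) \<noteq> 0"
    and R_nonzero: "R \<noteq> 0" and R_annihilates: "\<And>z. pval R (\<Psi> z) (g z) = 0"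
    and R_minimal: "\<And>Q. Q \<noteq> 0 \<Longrightarrow> (\<And>z. pval Q (\<Psi> z) (g z) = 0) \<Longrightarrow> degree R \<le> degree Q"
begin

lemma degree_R: "degree R > 0"
proof (rule ccontr)
  assume "\<not> degree R > 0"
  then obtain a where a: "R = [:a:]" by (metis degree_eq_zeroE gr0I)
  then have "a \<noteq> 0" using R_nonzero by auto
  with dominant R_annihilates a show False by fastforce
qed

lemma annihilators_prime:
  assumes "\<And>z. pval (P * Q) (\<Psi> z) (g z) = 0"
  shows "(\<forall>z. pval P (\<Psi> z) (g z) = 0) \<or> (\<forall>z. pval Q (\<Psi> z) (g z) = 0)"
proof -
  have "polyfun (\<lambda>z. pval S (\<Psi> z) (g z))" for S
    using polyfun_\<Psi> polyfun_g by (rule polyfun_pval)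
  from polyfun_mult_nonzero[OF this this, of P _ Q] show ?thesis using assms by fastforce
qed

text \<open>
  Pseudo-division by \<open>R\<close> leaves a remainder that annihilates as well and hence is zero. This transfers
  identities that hold at all points of the source to all roots of \<open>R\<close>, of which it is not yet known that
  they come from points of the source.
\<close>

lemma annihilator_vanishes_on_roots:
  assumes "\<And>z. pval Q (\<Psi> z) (g z) = 0" "pval R y T = 0" "ev (lead_coeff R) y \<noteq> 0"
  shows "pval Q y T = 0"
proof -
  obtain q r where qr: "pseudo_divmod Q R = (q, r)" by fastforce
  let ?k = "Suc (degree Q) - degree R"
  have eq: "smult (lead_coeff R ^ ?k) Q = R * q + r" and r: "r = 0 \<or> degree r < degree R"
    using pseudo_divmod[OF R_nonzero qr] by auto
  have "pval r (\<Psi> z) (g z) = 0" for z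
    using arg_cong[OF eq, of "\<lambda>P. pval P (\<Psi> z) (g z)"] assms(1) R_annihilates by simp
  with R_minimal r have "r = 0" by (metis linorder_not_le)
  then show ?thesis
    using arg_cong[OF eq, of "\<lambda>P. pval P y T"] assms(2,3) by simp
qed

text \<open>
  \<open>R\<close> is irreducible up to factors without the variable, so \<open>R\<close> and its derivative have no common factor
  and some element of the coefficient ring is a combination of both. That element stands in for the
  discriminant.
\<close>

lemma bezout_pderiv: "\<exists>d A B. d \<noteq> 0 \<and> A * R + B * pderiv R = [:d:]"
proof -
  \<comment> \<open>A nonzero combination of least degree divides a multiple of \<open>R\<close>; were its degree positive, it and
    the cofactor would have smaller degree than \<open>R\<close>, and one of them would annihilate.\<close>
  let ?I = "\<lambda>P. P \<noteq> 0 \<and> (\<exists>A B. P = A * R + B * pderiv R)"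
  have pd: "pderiv R \<noteq> 0" using degree_R by (simp add: pderiv_eq_0_iff)
  have "?I (pderiv R)" using pd by (auto intro: exI[of _ 0] exI[of _ 1])
  then obtain P where P: "?I P" and min: "\<And>Q. ?I Q \<Longrightarrow> degree P \<le> degree Q"
    using ex_has_least_nat[of ?I "pderiv R" degree] by blast
  then obtain A B where AB: "P = A * R + B * pderiv R" by blast
  obtain q r where qr: "pseudo_divmod R P = (q, r)" by fastforce
  let ?c = "lead_coeff P ^ (Suc (degree R) - degree P)"
  have eq: "smult ?c R = P * q + r" and r: "r = 0 \<or> degree r < degree P"
    using pseudo_divmod[OF _ qr] P by auto
  have "r = (smult ?c 1 - q * A) * R + (- q * B) * pderiv R"
    using eq unfolding AB by (simp add: algebra_simps)
  then have "r = 0" using min[of r] r by (metis linorder_not_le)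
  have c: "?c \<noteq> 0" using P by simp
  have Pq: "smult ?c R = P * q" using eq \<open>r = 0\<close> by simp
  have nz: "P \<noteq> 0" "q \<noteq> 0" using Pq c R_nonzero by auto
  have deg: "degree R = degree P + degree q"
    using arg_cong[OF Pq, of degree] c nz by (simp add: degree_mult_eq)
  have "degree P < degree R"
    using min[of "pderiv R"] \<open>?I (pderiv R)\<close> degree_R by (simp add: degree_pderiv)
  then have "\<not> (\<forall>z. pval P (\<Psi> z) (g z) = 0)" using R_minimal[of P] nz by auto
  moreover have "pval (P * q) (\<Psi> z) (g z) = 0" for z
    using R_annihilates by (simp flip: Pq)
  ultimately have "\<forall>z. pval q (\<Psi> z) (g z) = 0" using annihilators_prime[of P q] by blast
  then have "degree R \<le> degree q" using R_minimal[of q] nz by blast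
  then have "degree P = 0" using deg by simp
  then obtain d where "P = [:d:]" by (metis degree_eq_zeroE)
  then show ?thesis using AB nz by (metis pCons_0_0)
qed

lemma map_poly_ev_R:
  assumes "ev (lead_coeff R) y \<noteq> 0"
  shows "map_poly (\<lambda>a. ev a y) R \<noteq> 0" "degree (map_poly (\<lambda>a. ev a y) R) = degree R"
proof -
  show "degree (map_poly (\<lambda>a. ev a y) R) = degree R"
    using assms by (rule map_poly_degree_eq)
  show "map_poly (\<lambda>a. ev a y) R \<noteq> 0"
    using assms by (metis coeff_0 coeff_map_poly zero_pfun.rep_eq)
qed

lemma finite_roots_R:
  assumes "ev (lead_coeff R) y \<noteq> 0"
  shows "finite {T. pval R y T = 0}" "card {T. pval R y T = 0} \<le> degree R"
  using map_poly_ev_R[OF assms] poly_roots_finite card_poly_roots_bound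
  unfolding pval_def by metis+

lemma card_roots_R:
  assumes "A * R + B * pderiv R = [:d:]" "ev d y \<noteq> 0" "ev (lead_coeff R) y \<noteq> 0"
  shows "card {T. pval R y T = 0} = degree R"
proof -
  let ?p = "map_poly (\<lambda>a. ev a y) R"
  have "\<not> (pval R y T = 0 \<and> pval (pderiv R) y T = 0)" for T
    using arg_cong[OF assms(1), of "\<lambda>P. pval P y T"] assms(2) by auto
  then have "rsquarefree ?p"
    unfolding rsquarefree_roots pval_pderiv by (simp add: pval_def)
  then have eq: "?p = smult (lead_coeff ?p) (\<Prod>z|poly ?p z = 0. [:-z, 1:])"
    by (rule complex_poly_decompose_rsquarefree[symmetric])
  have "degree ?p = degree (\<Prod>z|poly ?p z = 0. [:-z, 1:])"
    using map_poly_ev_R(1)[OF assms(3)] by (subst eq) simp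
  also have "\<dots> = card {z. poly ?p z = 0}"
    by (subst degree_prod_eq_sum_degree) auto
  finally show ?thesis using map_poly_ev_R(2)[OF assms(3)] by (simp add: pval_def)
qed

end

text \<open>
  Substituting fractions with denominator \<open>d\<close> into a polynomial and clearing denominators.
\<close>

lemma homogenize:
  assumes "polyfun f"
  shows "\<exists>n H. \<forall>y T. ev d y \<noteq> 0 \<longrightarrow> pval H y T = ev d y ^ n * f (\<lambda>i. pval (G i) y T / ev d y)"
  using assms
proof induction
  case (polyfun_const c)
  show ?case
    by (intro exI[of _ 0] exI[of _ "[:Pfun (\<lambda>_. c):]"]) (simp add: Pfun_inverse polyfun.polyfun_const)
next
  case (polyfun_coord i)
  show ?case by (intro exI[of _ 1] exI[of _ "G i"]) simp
next
  case (polyfun_add f g)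
  then obtain n H m K where
      "\<And>y T. ev d y \<noteq> 0 \<Longrightarrow> pval H y T = ev d y ^ n * f (\<lambda>i. pval (G i) y T / ev d y)"
      "\<And>y T. ev d y \<noteq> 0 \<Longrightarrow> pval K y T = ev d y ^ m * g (\<lambda>i. pval (G i) y T / ev d y)" by blast
  then show ?case
    by (intro exI[of _ "n + m"] exI[of _ "smult (d ^ m) H + smult (d ^ n) K"])
      (simp add: algebra_simps power_add)
next
  case (polyfun_mult f g)
  then obtain n H m K where
      "\<And>y T. ev d y \<noteq> 0 \<Longrightarrow> pval H y T = ev d y ^ n * f (\<lambda>i. pval (G i) y T / ev d y)"
      "\<And>y T. ev d y \<noteq> 0 \<Longrightarrow> pval K y T = ev d y ^ m * g (\<lambda>i. pval (G i) y T / ev d y)" by blast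
  then show ?case
    by (intro exI[of _ "n + m"] exI[of _ "H * K"]) (simp add: algebra_simps power_add)
qed

text \<open>
  The number of points of a fibre can only be exceptionally small on a proper subvariety. The proof is
  Kronecker's elimination. Add a parameter $t_i$ for each coordinate, put
  $\Psi(z,t) = (\Phi(z),t)$ and $\ell = \sum_i t_i z_i$, and take the minimal annihilator $R(y,t,T)$
  of $\ell$.
  \<^item> For some $y$ with $n$ points in its fibre and general $t$, the form $\ell$ separates these points, and
    its $n$ values are roots of $R(y,t,\cdot)$. Hence $R$ has degree at least $n$.
  \<^item> Differentiating $R(\Phi(z),t,\ell)=0$ with respect to $t_i$ gives
    $R_{t_i} + z_i R_T = 0$. Hence each $z_i$ is a rational function of $(\Phi(z),t,\ell)$ whose
    denominator can be taken to be the combination of $R$ and $R_T$ that is free of $T$.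
  \<^item> For general $(y,t)$ the polynomial $R(y,t,\cdot)$ has as many roots as its degree says. Inserting a
    root into these rational functions yields a point $z$ with $\Phi(z)=y$ and $\ell(z)=T$, because both
    equations are identities on the source and thus hold on roots. Distinct roots give distinct points.

  The hypothesis on \<open>U\<close> is Zariski density. Open sets in the usual topology have it.
\<close>

theorem for_general_fibre:
  fixes \<Phi> :: "('i::finite \<Rightarrow> complex) \<Rightarrow> 'i \<Rightarrow> complex"
  assumes \<Phi>: "\<And>i. polyfun (\<lambda>z. \<Phi> z i)"
    and dense: "\<And>f. polyfun f \<Longrightarrow> \<exists>x. f x \<noteq> 0 \<Longrightarrow> \<exists>y\<in>U. f y \<noteq> 0"
    and U: "\<And>y. y \<in> U \<Longrightarrow> at_least_elements n {z. \<Phi> z = y}"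
    and n: "n > 0"
  shows "for_general (\<lambda>y. at_least_elements n {z. \<Phi> z = y})"
proof -
  define \<Psi> :: "('i + 'i \<Rightarrow> complex) \<Rightarrow> 'i + 'i \<Rightarrow> complex" where
    "\<Psi> w = case_sum (\<Phi> (\<lambda>i. w (Inl i))) (\<lambda>i. w (Inr i))" for w
  define g :: "('i + 'i \<Rightarrow> complex) \<Rightarrow> complex" where
    "g w = (\<Sum>i\<in>UNIV. w (Inr i) * w (Inl i))" for w
  have polyfun_\<Psi>: "polyfun (\<lambda>w. \<Psi> w j)" for j
    unfolding \<Psi>_def by (cases j) (auto intro!: polyfun_intros polyfun_compose[OF \<Phi>])
  have polyfun_g: "polyfun g"
    unfolding g_def[abs_def] by (intro polyfun_intros)
  have polyfun_fst: "polyfun (\<lambda>y. f (case_sum y t))" if "polyfun f" for f :: "('i + 'i \<Rightarrow> complex) \<Rightarrow> complex" and t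
    by (rule polyfun_compose[OF that], case_tac j) (auto intro: polyfun_intros)
  have polyfun_snd: "polyfun (\<lambda>t. f (case_sum y t))" if "polyfun f" for f :: "('i + 'i \<Rightarrow> complex) \<Rightarrow> complex" and y
    by (rule polyfun_compose[OF that], case_tac j) (auto intro: polyfun_intros)
  have split: "\<exists>y t. w = case_sum y t" for w :: "'i + 'i \<Rightarrow> complex"
    by (intro exI[of _ "\<lambda>i. w (Inl i)"] exI[of _ "\<lambda>i. w (Inr i)"]) (auto split: sum.split)
  have meets_U: "\<exists>y\<in>U. \<exists>t. ev a (case_sum y t) \<noteq> 0" if a: "a \<noteq> 0" for a :: "('i + 'i) pfun"
  proof -
    obtain w where "ev a w \<noteq> 0" using a pfun_nonzero_iff by blast
    then obtain y t where "ev a (case_sum y t) \<noteq> 0" using split[of w] by metis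
    then have "\<exists>y. ev a (case_sum y t) \<noteq> 0" by blast
    from dense[OF polyfun_fst[OF polyfun_ev] this] show ?thesis by blast
  qed
  have dominant: "\<exists>w. ev a (\<Psi> w) \<noteq> 0" if a: "a \<noteq> 0" for a :: "('i + 'i) pfun"
  proof -
    obtain y t where y: "y \<in> U" "ev a (case_sum y t) \<noteq> 0" using meets_U[OF a] by blast
    obtain z where "\<Phi> z = y"
      using U[OF y(1)] n unfolding at_least_elements_def by fastforce
    then have "\<Psi> (case_sum z t) = case_sum y t" by (simp add: \<Psi>_def)
    then show ?thesis using y(2) by metis
  qed
  let ?ann = "\<lambda>R. R \<noteq> 0 \<and> (\<forall>w. pval R (\<Psi> w) (g w) = 0)"
  obtain R0 where "?ann R0"
    using annihilating_poly[of "\<lambda>j w. \<Psi> w j" g] polyfun_\<Psi> polyfun_g by auto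
  then obtain R where R: "?ann R" and R_min: "\<And>Q. ?ann Q \<Longrightarrow> degree R \<le> degree Q"
    using ex_has_least_nat[of ?ann R0 degree] by blast
  interpret minimal_annihilator \<Psi> g R
    by standard (use polyfun_\<Psi> polyfun_g dominant R R_min in auto)
  let ?lc = "lead_coeff R"
  have lc: "?lc \<noteq> 0" using R by simp

  \<comment> \<open>The degree is bounded below by separating the points of one fibre over \<open>U\<close>.\<close>
  have "n \<le> degree R"
  proof -
    obtain y t0 where y: "y \<in> U" and t0: "ev ?lc (case_sum y t0) \<noteq> 0" using meets_U[OF lc] by blast
    obtain S where S: "S \<subseteq> {z. \<Phi> z = y}" "finite S" "card S = n"
      using U[OF y] unfolding at_least_elements_def by blast
    let ?P = "{p \<in> S \<times> S. fst p \<noteq> snd p}"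
    let ?h = "\<lambda>p t. \<Sum>i\<in>UNIV. t i * (fst p i - snd p i)"
    have "\<exists>t. (\<Prod>p\<in>?P. ?h p t) \<noteq> 0"
    proof (rule polyfun_prod_nonzero)
      show "\<exists>t. ?h p t \<noteq> 0" if p: "p \<in> ?P" for p
      proof -
        obtain i where "fst p i \<noteq> snd p i" using p by (auto simp: fun_eq_iff)
        then have "?h p (\<lambda>j. if j = i then 1 else 0) \<noteq> 0"
          by (simp add: if_distrib[of "\<lambda>c. c * _"] cong: if_cong)
        then show ?thesis by (rule exI[of _ "\<lambda>j. if j = i then 1 else 0"])
      qed
    qed (use S in \<open>auto intro!: polyfun_intros\<close>)
    then obtain t1 where t1: "(\<Prod>p\<in>?P. ?h p t1) \<noteq> 0" ..
    have "\<exists>t. ev ?lc (case_sum y t) \<noteq> 0 \<and> (\<Prod>p\<in>?P. ?h p t) \<noteq> 0"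
    proof (rule polyfun_mult_nonzero[where a = t0 and b = t1])
      show "polyfun (\<lambda>t. ev ?lc (case_sum y t))" by (rule polyfun_snd[OF polyfun_ev])
      show "polyfun (\<lambda>t. \<Prod>p\<in>?P. ?h p t)" by (intro polyfun_intros)
    qed (fact t0 t1)+
    then obtain t where t: "ev ?lc (case_sum y t) \<noteq> 0" "(\<Prod>p\<in>?P. ?h p t) \<noteq> 0" by blast
    let ?l = "\<lambda>z. \<Sum>i\<in>UNIV. t i * z i"
    have "inj_on ?l S"
    proof (rule inj_onI, rule ccontr)
      fix z z' assume z: "z \<in> S" "z' \<in> S" "?l z = ?l z'" "z \<noteq> z'"
      then have "?h (z, z') t = 0" "(z, z') \<in> ?P"
        by (auto simp: right_diff_distrib sum_subtractf)
      moreover have "finite ?P" using S by simp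
      ultimately have "(\<Prod>p\<in>?P. ?h p t) = 0" by (intro prod_zero bexI)
      with t(2) show False by contradiction
    qed
    moreover have "?l ` S \<subseteq> {T. pval R (case_sum y t) T = 0}"
    proof safe
      fix z assume "z \<in> S"
      then have "\<Psi> (case_sum z t) = case_sum y t" "g (case_sum z t) = ?l z"
        using S(1) by (auto simp: \<Psi>_def g_def)
      then show "pval R (case_sum y t) (?l z) = 0" using R_annihilates[of "case_sum z t"] by simp
    qed
    ultimately have "card S \<le> card {T. pval R (case_sum y t) T = 0}"
      using finite_roots_R(1)[OF t(1)] by (rule card_inj_on_le)
    then show ?thesis using finite_roots_R[OF t(1)] S(3) by simp
  qed

  obtain d A B where d: "d \<noteq> 0" and AB: "A * R + B * pderiv R = [:d:]"
    using bezout_pderiv by blast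
  \<comment> \<open>Recovering the coordinates: \<open>- B * Q\<close> with $Q = R_{t_i}$ represents $z_i d$, since $B R_T = d$ modulo \<open>R\<close>.\<close>
  have "\<exists>G. \<forall>w. pval G (\<Psi> w) (g w) = ev d (\<Psi> w) * w (Inl i)" for i
  proof -
    obtain Q where Q: "\<And>y T v. ((\<lambda>s. pval R (y(Inr i := y (Inr i) + s)) (T + s * v)) has_field_derivative
        pval Q y T + v * pval (pderiv R) y T) (at 0)"
      using pval_partial_derivative[of R "Inr i"] by blast
    have "pval (- B * Q) (\<Psi> w) (g w) = ev d (\<Psi> w) * w (Inl i)" for w
    proof -
      have "pval R ((\<Psi> w)(Inr i := \<Psi> w (Inr i) + s)) (g w + s * w (Inl i)) = 0" for s
      proof -
        let ?w = "w(Inr i := w (Inr i) + s)"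
        have "\<Psi> ?w = (\<Psi> w)(Inr i := \<Psi> w (Inr i) + s)"
          by (rule ext) (auto simp: \<Psi>_def split: sum.split)
        moreover have "g ?w = g w + s * w (Inl i)"
          by (simp add: g_def sum.remove[of UNIV i] algebra_simps)
        ultimately show ?thesis using R_annihilates[of ?w] by (simp del: fun_upd_apply)
      qed
      then have "((\<lambda>s. 0) has_field_derivative
          pval Q (\<Psi> w) (g w) + w (Inl i) * pval (pderiv R) (\<Psi> w) (g w)) (at 0)"
        using Q[of "\<Psi> w" "g w" "w (Inl i)"] by simp
      then have *: "pval Q (\<Psi> w) (g w) + w (Inl i) * pval (pderiv R) (\<Psi> w) (g w) = 0"
        using DERIV_unique[OF _ DERIV_const] by blast
      have "ev d (\<Psi> w) = pval B (\<Psi> w) (g w) * pval (pderiv R) (\<Psi> w) (g w)"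
        using arg_cong[OF AB, of "\<lambda>P. pval P (\<Psi> w) (g w)"] R by simp
      then show ?thesis using * by (simp add: eq_neg_iff_add_eq_0[symmetric] add_eq_0_iff)
    qed
    then show ?thesis by blast
  qed
  then obtain G where G: "\<And>i w. pval (G i) (\<Psi> w) (g w) = ev d (\<Psi> w) * w (Inl i)" by metis

  \<comment> \<open>The formulas for the coordinates turn every root of \<open>R\<close> into a point of the fibre.\<close>
  have fibre: "\<Phi> (\<lambda>i. pval (G i) w T / ev d w) = (\<lambda>i. w (Inl i))"
    and form: "(\<Sum>i\<in>UNIV. w (Inr i) * (pval (G i) w T / ev d w)) = T"
    if w: "ev d w \<noteq> 0" "ev ?lc w \<noteq> 0" "pval R w T = 0" for w T
  proof -
    show "\<Phi> (\<lambda>i. pval (G i) w T / ev d w) = (\<lambda>i. w (Inl i))"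
    proof
      fix j
      obtain k H where H: "\<And>y T. ev d y \<noteq> 0 \<Longrightarrow>
          pval H y T = ev d y ^ k * \<Phi> (\<lambda>i. pval (G i) y T / ev d y) j"
        using homogenize[OF \<Phi>, of d G j] by blast
      \<comment> \<open>The factor \<open>d\<close> makes \<open>Q\<close> annihilate also where \<open>d\<close> vanishes and \<open>H\<close> is unknown.\<close>
      define Q where "Q = smult d (H - smult (d ^ k) [:Pfun (\<lambda>w. w (Inl j)):])"
      have Q: "pval Q y T = ev d y * (pval H y T - ev d y ^ k * y (Inl j))" for y T
        by (simp add: Q_def Pfun_inverse polyfun_coord)
      have "pval Q (\<Psi> w) (g w) = 0" for w
      proof (cases "ev d (\<Psi> w) = 0")
        case False
        then have "(\<lambda>i. pval (G i) (\<Psi> w) (g w) / ev d (\<Psi> w)) = (\<lambda>i. w (Inl i))"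
          by (simp add: G)
        then show ?thesis using H[OF False, of "g w"] by (simp add: Q \<Psi>_def)
      qed (simp add: Q)
      then have "pval Q w T = 0" using annihilator_vanishes_on_roots w by blast
      then show "\<Phi> (\<lambda>i. pval (G i) w T / ev d w) j = w (Inl j)"
        using H[OF w(1), of T] w(1) by (simp add: Q)
    qed
    define Q where "Q = (\<Sum>i\<in>UNIV. smult (Pfun (\<lambda>w. w (Inr i))) (G i)) - smult d [:0, 1:]"
    have Q: "pval Q y T = (\<Sum>i\<in>UNIV. y (Inr i) * pval (G i) y T) - ev d y * T" for y T
      by (simp add: Q_def pval_sum Pfun_inverse polyfun_coord)
    have "\<Psi> w (Inr i) = w (Inr i)" for w i by (simp add: \<Psi>_def)
    then have "pval Q (\<Psi> w) (g w) = 0" for w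
      unfolding Q G by (simp add: g_def sum_distrib_left mult_ac)
    then have "pval Q w T = 0" using annihilator_vanishes_on_roots w by blast
    then show "(\<Sum>i\<in>UNIV. w (Inr i) * (pval (G i) w T / ev d w)) = T"
      using w(1) by (simp add: Q sum_divide_distrib[symmetric] field_simps)
  qed

  obtain y0 t where yt: "ev (d * ?lc) (case_sum y0 t) \<noteq> 0"
    using meets_U[of "d * ?lc"] d lc by auto
  have "at_least_elements n {z. \<Phi> z = y}" if y: "ev (d * ?lc) (case_sum y t) \<noteq> 0" for y
  proof -
    let ?w = "case_sum y t"
    have w: "ev d ?w \<noteq> 0" "ev ?lc ?w \<noteq> 0" using y by auto
    show ?thesis
    proof (rule at_least_elementsI)
      show "finite {T. pval R ?w T = 0}" using finite_roots_R[OF w(2)] by simp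
      show "n \<le> card {T. pval R ?w T = 0}"
        using card_roots_R[OF AB w] \<open>n \<le> degree R\<close> by simp
      show "inj_on (\<lambda>T i. pval (G i) ?w T / ev d ?w) {T. pval R ?w T = 0}"
      proof (rule inj_onI)
        fix S T assume ST: "S \<in> {T. pval R ?w T = 0}" "T \<in> {T. pval R ?w T = 0}"
          and "(\<lambda>i. pval (G i) ?w S / ev d ?w) = (\<lambda>i. pval (G i) ?w T / ev d ?w)"
        then have "pval (G i) ?w S / ev d ?w = pval (G i) ?w T / ev d ?w" for i by meson
        then have "(\<Sum>i\<in>UNIV. ?w (Inr i) * (pval (G i) ?w S / ev d ?w)) =
            (\<Sum>i\<in>UNIV. ?w (Inr i) * (pval (G i) ?w T / ev d ?w))" by (simp only:)
        then show "S = T" using form[OF w, of S] form[OF w, of T] ST by (simp only: mem_Collect_eq)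
      qed
      show "(\<lambda>T i. pval (G i) ?w T / ev d ?w) ` {T. pval R ?w T = 0} \<subseteq> {z. \<Phi> z = y}"
        using fibre[OF w] by auto
    qed
  qed
  moreover have "polyfun (\<lambda>y. ev (d * ?lc) (case_sum y t))"
    by (rule polyfun_fst[OF polyfun_ev])
  ultimately show ?thesis
    unfolding for_general_iff using yt
    by (intro exI[of _ "\<lambda>y. ev (d * ?lc) (case_sum y t)"] conjI exI[of _ y0] allI impI)
qed

section \<open>Nondegenerate points of a fibre\<close>

lemma vec_nth_vec_lambda [simp]: "vec_nth (vec_lambda f) = f"
  by (simp add: fun_eq_iff)

lemma polyfun_has_derivative:
  assumes "polyfun f"
  shows "\<exists>f'. ((\<lambda>x :: complex ^ 'i::finite. f (vec_nth x)) has_derivative f') (at x)"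
  using assms
proof induction
  case (polyfun_const c)
  show ?case using has_derivative_const by blast
next
  case (polyfun_coord i)
  show ?case using bounded_linear_imp_has_derivative[OF bounded_linear_vec_nth] by blast
next
  case (polyfun_add f g)
  then show ?case using has_derivative_add by blast
next
  case (polyfun_mult f g)
  then show ?case using has_derivative_mult by blast
qed

text \<open>
  The complex directional derivatives of a polynomial function are the values of its real total
  derivative: both describe the restriction to a complex line.
\<close>

lemma polyfun_directional_derivative:
  fixes z h :: "complex ^ 'i::finite"
  assumes "polyfun f" "((\<lambda>x. f (vec_nth x)) has_derivative f') (at z)"
  shows "((\<lambda>s. f (\<lambda>i. z $ i + s * h $ i)) has_field_derivative f' h) (at 0)"
proof -
  let ?l = "\<lambda>s. \<chi> i. s * h $ i"
  have "linear ?l"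
    by (rule linearI) (simp_all add: vec_eq_iff algebra_simps)
  then have "(?l has_derivative ?l) (at 0)"
    by (intro bounded_linear_imp_has_derivative) (simp add: linear_conv_bounded_linear)
  then have "((\<lambda>s. z + ?l s) has_derivative ?l) (at 0)"
    using has_derivative_add[OF has_derivative_const] by fastforce
  moreover have "((\<lambda>x. f (vec_nth x)) has_derivative f') (at (z + ?l 0))"
    using assms(2) by (simp add: vec_eq_iff zero_vec_def[symmetric])
  ultimately have "((\<lambda>s. f (vec_nth (z + ?l s))) has_derivative (\<lambda>s. f' (?l s))) (at 0)"
    by (rule has_derivative_compose)
  then have total: "((\<lambda>s. f (\<lambda>i. z $ i + s * h $ i)) has_derivative (\<lambda>s. f' (?l s))) (at 0)"
    by (simp add: plus_vec_def)
  obtain p where p: "\<And>s. f (\<lambda>i. z $ i + s * h $ i) = poly p s"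
    using polyfun_on_line[OF assms(1)] by blast
  have line: "((\<lambda>s. f (\<lambda>i. z $ i + s * h $ i)) has_field_derivative poly (pderiv p) 0) (at 0)"
    unfolding p by (rule poly_DERIV)
  have "(\<lambda>s. f' (?l s)) = (*) (poly (pderiv p) 0)"
    using has_derivative_unique[OF total line[unfolded has_field_derivative_def]] .
  from fun_cong[OF this, of 1] have "f' h = poly (pderiv p) 0" by simp
  with line show ?thesis by simp
qed

text \<open>
  On the line from a point of the open set to a non-zero of \<open>f\<close>, infinitely many points lie in the open
  set but only finitely many are zeros.
\<close>

lemma polyfun_nonzero_on_open:
  fixes O' :: "(complex ^ 'i::finite) set"
  assumes "polyfun f" "f a \<noteq> 0" "open O'" "b \<in> O'"
  shows "\<exists>y\<in>O'. f (vec_nth y) \<noteq> 0"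
proof -
  let ?l = "\<lambda>s. \<chi> i. b $ i + s * (a i - b $ i)"
  obtain p where p: "\<And>s. f (\<lambda>i. b $ i + s * (a i - b $ i)) = poly p s"
    using polyfun_on_line[OF assms(1), of "vec_nth b" "\<lambda>i. a i - b $ i"] by blast
  have "poly p 1 \<noteq> 0" using assms(2) by (simp flip: p)
  then have fin: "finite {s. poly p s = 0}" by (intro poly_roots_finite) auto
  have "continuous_on UNIV ?l" by (intro continuous_intros)
  then have "open (?l -` O')" using assms(3) by (simp add: open_vimage)
  moreover have "0 \<in> ?l -` O'" using assms(4) by simp
  ultimately have "\<not> ?l -` O' \<subseteq> {s. poly p s = 0}"
    using fin finite_imp_not_open finite_subset by blast
  then obtain s where "?l s \<in> O'" "poly p s \<noteq> 0" by blast
  then show ?thesis by (intro bexI[of _ "?l s"]) (simp_all add: p)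
qed

lemma disjoint_balls:
  fixes S :: "'a::metric_space set"
  assumes "finite S"
  shows "\<exists>e>0. \<forall>x\<in>S. \<forall>y\<in>S. x \<noteq> y \<longrightarrow> ball x e \<inter> ball y e = {}"
proof -
  let ?D = "insert 1 ((\<lambda>(x, y). dist x y) ` {p \<in> S \<times> S. fst p \<noteq> snd p})"
  have fin: "finite ?D" using assms by simp
  have "ball x (Min ?D / 2) \<inter> ball y (Min ?D / 2) = {}" if "x \<in> S" "y \<in> S" "x \<noteq> y" for x y
  proof -
    have "Min ?D \<le> dist x y" using fin by (rule Min_le) (use that in force)
    then show ?thesis by (intro disjoint_ballI) simp
  qed
  moreover have "Min ?D / 2 > 0" using fin by auto
  ultimately show ?thesis by blast
qed

text \<open>
  At each of the given points the derivative is invertible, so by the open mapping property small disjoint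
  balls around the points are mapped onto neighbourhoods of \<open>y0\<close>. All targets in the intersection of
  these neighbourhoods have as many preimages as there are points, and the intersection is open.
\<close>

theorem for_general_nondegenerate:
  fixes \<Phi> :: "('i::finite \<Rightarrow> complex) \<Rightarrow> 'i \<Rightarrow> complex"
  assumes \<Phi>: "\<And>i. polyfun (\<lambda>z. \<Phi> z i)"
    and P: "finite P" "P \<noteq> {}" "\<And>z. z \<in> P \<Longrightarrow> \<Phi> z = y0"
    and nondegenerate: "\<And>z h. z \<in> P \<Longrightarrow>
      (\<And>i. ((\<lambda>s. \<Phi> (\<lambda>j. z j + s * h j) i) has_field_derivative 0) (at 0)) \<Longrightarrow> h = (\<lambda>_. 0)"
  shows "for_general (\<lambda>y. at_least_elements (card P) {z. \<Phi> z = y})"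
proof -
  define F :: "complex ^ 'i \<Rightarrow> complex ^ 'i" where "F x = (\<chi> i. \<Phi> (vec_nth x) i)" for x
  define f' where "f' x i = (SOME L. ((\<lambda>x :: complex ^ 'i. \<Phi> (vec_nth x) i) has_derivative L) (at x))" for x i
  have f': "((\<lambda>x :: complex ^ 'i. \<Phi> (vec_nth x) i) has_derivative f' x i) (at x)" for i x
    unfolding f'_def using polyfun_has_derivative[OF \<Phi>[of i], of x] by (rule someI_ex)
  define F' where "F' x h = (\<chi> i. f' x i h)" for x h
  have F': "(F has_derivative F' x) (at x)" for x
    unfolding F_def F'_def
    by (subst has_derivative_componentwise_within)
      (auto simp: Basis_vec_def inner_axis intro!: has_derivative_inner_left f')
  have open_at: "vec_lambda y0 \<in> interior (F ` ball (vec_lambda z) e)" if z: "z \<in> P" and e: "e > 0" for z e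
  proof -
    let ?z = "vec_lambda z :: complex ^ 'i"
    have lin: "linear (F' ?z)"
      using F'[of ?z] has_derivative_bounded_linear linear_conv_bounded_linear by blast
    have "h = 0" if "F' ?z h = 0" for h
    proof -
      have "f' ?z i h = 0" for i using that by (simp add: F'_def vec_eq_iff)
      then have "((\<lambda>s. \<Phi> (\<lambda>j. z j + s * h $ j) i) has_field_derivative 0) (at 0)" for i
        using polyfun_directional_derivative[OF \<Phi> f', of ?z h i] by simp
      then have "(\<lambda>j. h $ j) = (\<lambda>_. 0)" using nondegenerate[OF z] by blast
      then show ?thesis by (simp add: vec_eq_iff fun_eq_iff)
    qed
    then have "inj (F' ?z)" using lin by (simp add: linear_injective_0)
    with lin have "surj (F' ?z)" by (rule linear_inj_imp_surj)
    with lin obtain g where "linear g" "F' ?z \<circ> g = id"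
      using linear_surjective_right_inverse[OF lin] by blast
    moreover have "continuous_on UNIV F"
      by (rule has_derivative_continuous_on[of _ _ F']) (use F' in simp)
    moreover have "?z \<in> interior (ball ?z e)" using e by (simp add: interior_open)
    ultimately have "F ?z \<in> interior (F ` ball ?z e)"
      using sussmann_open_mapping[of UNIV F ?z "F' ?z" g "ball ?z e"] F'
      by (simp add: linear_conv_bounded_linear)
    moreover have "F ?z = vec_lambda y0" using P(3)[OF z] by (simp add: F_def)
    ultimately show ?thesis by simp
  qed
  let ?v = "vec_lambda :: ('i \<Rightarrow> complex) \<Rightarrow> complex ^ 'i"
  have inj_v: "inj ?v" by (rule injI) (metis vec_lambda_inject UNIV_I)
  obtain e where e: "e > 0"
    and disj: "\<And>z z'. z \<in> P \<Longrightarrow> z' \<in> P \<Longrightarrow> z \<noteq> z' \<Longrightarrow> ball (?v z) e \<inter> ball (?v z') e = {}"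
    using disjoint_balls[of "?v ` P"] P(1) inj_v by (auto simp: inj_eq)
  define W where "W = (\<Inter>z\<in>P. interior (F ` ball (?v z) e))"
  have W: "open W" "?v y0 \<in> W"
    using P(1) open_at e by (auto simp: W_def intro: open_INT)
  show ?thesis
  proof (rule for_general_fibre[where U = "vec_nth ` W"])
    fix f :: "('i \<Rightarrow> complex) \<Rightarrow> complex" assume "polyfun f" "\<exists>x. f x \<noteq> 0"
    then show "\<exists>y\<in>vec_nth ` W. f y \<noteq> 0" using polyfun_nonzero_on_open[OF _ _ W] by blast
  next
    fix y assume "y \<in> vec_nth ` W"
    then obtain x where x: "x \<in> W" "y = vec_nth x" by blast
    have "\<exists>x'. x' \<in> ball (?v z) e \<and> F x' = x" if "z \<in> P" for z
      using x(1) that interior_subset unfolding W_def by blast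
    then obtain h where h: "\<And>z. z \<in> P \<Longrightarrow> h z \<in> ball (?v z) e" "\<And>z. z \<in> P \<Longrightarrow> F (h z) = x"
      by metis
    show "at_least_elements (card P) {z. \<Phi> z = y}"
    proof (rule at_least_elementsI[OF P(1) order_refl])
      show "inj_on (\<lambda>z. vec_nth (h z)) P"
        using h(1) disj by (intro inj_onI) (metis IntI empty_iff vec_nth_inject)
      show "(\<lambda>z. vec_nth (h z)) ` P \<subseteq> {z. \<Phi> z = y}"
        using h(2) x(2) by (auto simp: F_def vec_eq_iff fun_eq_iff)
    qed
  qed (use P \<Phi> card_gt_0_iff in auto)
qed

section \<open>A block with $5^M$ nondegenerate solutions\<close>

instance block_coeff :: (finite) finite
proof
  have "b \<in> range A0 \<union> range A1 \<union> range B0 \<union> range B1 \<union> range C \<union> range D"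
    for b :: "'a block_coeff" by (cases b) auto
  then have "(UNIV :: 'a block_coeff set) \<subseteq>
      range A0 \<union> range A1 \<union> range B0 \<union> range B1 \<union> range C \<union> range D" by blast
  then show "finite (UNIV :: 'a block_coeff set)" by (rule finite_subset) simp
qed

text \<open>
  The special block has $p_k = u_k (1 + 2S - s_k)$ and $q_k = v_k (-1 + 2S - s_k)$ with
  $s_k = u_k^2 + v_k^2$ and $S = \sum_j s_j$. Since the two constants differ, $u_k$ and $v_k$ cannot both be
  nonzero in a solution. For each frequency this leaves five possibilities: both zero, or
  $u_k = \pm\sqrt{2S+1}$, or $v_k = \pm\sqrt{2S-1}$.
\<close>

definition base_block :: "'m block_coeff \<Rightarrow> complex" where
  "base_block s = (case s of A1 k \<Rightarrow> 1 | B1 k \<Rightarrow> - 1 | D k \<Rightarrow> 1 | _ \<Rightarrow> 0)"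

lemma base_block_simps [simp]:
  "base_block (A0 k) = 0" "base_block (A1 k) = 1" "base_block (B0 k) = 0"
  "base_block (B1 k) = - 1" "base_block (C k) = 0" "base_block (D k) = 1"
  by (simp_all add: base_block_def)

definition intensity :: "complex ^ 'm \<Rightarrow> complex ^ 'm \<Rightarrow> 'm \<Rightarrow> complex" where
  "intensity u v k = (u $ k)\<^sup>2 + (v $ k)\<^sup>2"

text \<open>
  The terms of degree three depend on the other frequencies only through the sum of all intensities.
  Given that sum, the equations for the $k$-th frequency are linear in $u_k$, $v_k$ up to the value of
  the intensity itself.
\<close>

lemma block_p_intensity:
  "block_p a u v k = a (A0 k) + a (A1 k) * u $ k + a (C k) * v $ k
     + a (D k) * u $ k * (2 * (\<Sum>j\<in>UNIV. intensity u v j) - intensity u v k)"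
proof -
  have "(\<Sum>j\<in>UNIV. intensity u v j) = intensity u v k + (\<Sum>j\<in>UNIV - {k}. intensity u v j)"
    by (simp add: sum.remove)
  moreover have "(\<Sum>j\<in>UNIV - {k}. u $ k * ((u $ j)\<^sup>2 + (v $ j)\<^sup>2)) = u $ k * (\<Sum>j\<in>UNIV - {k}. intensity u v j)"
    by (simp add: intensity_def sum_distrib_left)
  ultimately show ?thesis
    unfolding block_p_def intensity_def[symmetric] by (simp add: intensity_def[symmetric] algebra_simps)
qed

lemma block_q_intensity:
  "block_q a u v k = a (B0 k) - a (C k) * u $ k + a (B1 k) * v $ k
     + a (D k) * v $ k * (2 * (\<Sum>j\<in>UNIV. intensity u v j) - intensity u v k)"
proof -
  have "(\<Sum>j\<in>UNIV. intensity u v j) = intensity u v k + (\<Sum>j\<in>UNIV - {k}. intensity u v j)"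
    by (simp add: sum.remove)
  moreover have "(\<Sum>j\<in>UNIV - {k}. v $ k * ((u $ j)\<^sup>2 + (v $ j)\<^sup>2)) = v $ k * (\<Sum>j\<in>UNIV - {k}. intensity u v j)"
    by (simp add: intensity_def sum_distrib_left)
  ultimately show ?thesis
    unfolding block_q_def intensity_def[symmetric] by (simp add: intensity_def[symmetric] algebra_simps)
qed

lemma base_block_p:
  "block_p base_block u v k = u $ k * (1 + 2 * (\<Sum>j\<in>UNIV. intensity u v j) - intensity u v k)"
  unfolding block_p_intensity by (simp add: algebra_simps)

lemma base_block_q:
  "block_q base_block u v k = v $ k * (2 * (\<Sum>j\<in>UNIV. intensity u v j) - 1 - intensity u v k)"
  unfolding block_q_intensity by (simp add: algebra_simps)

text \<open>
  A state records for each frequency whether it vanishes (\<open>None\<close>), lies along $u$ (\<open>False\<close>) or along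
  $v$ (\<open>True\<close>), together with a sign.
\<close>

type_synonym 'm state = "'m \<Rightarrow> (bool \<times> bool) option"

definition along_u :: "'m state \<Rightarrow> 'm set" where
  "along_u \<tau> = {k. \<exists>b. \<tau> k = Some (False, b)}"

definition along_v :: "'m state \<Rightarrow> 'm set" where
  "along_v \<tau> = {k. \<exists>b. \<tau> k = Some (True, b)}"

text \<open>
  If $p$ frequencies lie along $u$ and $q$ along $v$, the intensities add up to
  $S = p(2S+1) + q(2S-1)$. This is solved for $S$.
\<close>

definition state_sum :: "'m::finite state \<Rightarrow> complex" where
  "state_sum \<tau> = (of_nat (card (along_v \<tau>)) - of_nat (card (along_u \<tau>))) /
     (2 * (of_nat (card (along_u \<tau>)) + of_nat (card (along_v \<tau>))) - 1)"

definition state_u :: "'m::finite state \<Rightarrow> complex ^ 'm" where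
  "state_u \<tau> = (\<chi> k. case \<tau> k of
     Some (False, b) \<Rightarrow> (if b then 1 else - 1) * csqrt (2 * state_sum \<tau> + 1) | _ \<Rightarrow> 0)"

definition state_v :: "'m::finite state \<Rightarrow> complex ^ 'm" where
  "state_v \<tau> = (\<chi> k. case \<tau> k of
     Some (True, b) \<Rightarrow> (if b then 1 else - 1) * csqrt (2 * state_sum \<tau> - 1) | _ \<Rightarrow> 0)"

lemma state_u_nth: "state_u \<tau> $ k =
    (case \<tau> k of Some (False, b) \<Rightarrow> (if b then 1 else - 1) * csqrt (2 * state_sum \<tau> + 1) | _ \<Rightarrow> 0)"
  by (simp add: state_u_def)

lemma state_v_nth: "state_v \<tau> $ k =
    (case \<tau> k of Some (True, b) \<Rightarrow> (if b then 1 else - 1) * csqrt (2 * state_sum \<tau> - 1) | _ \<Rightarrow> 0)"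
  by (simp add: state_v_def)

text \<open>
  Parity keeps everything away from zero: the denominator $2(p+q)-1$ is odd, and $2S+1$ and $2S-1$ are
  $4q-1$ and $1-4p$ divided by it.
\<close>

lemma state_sum_facts:
  fixes \<tau> :: "'m::finite state"
  defines "p \<equiv> of_nat (card (along_u \<tau>)) :: complex" and "q \<equiv> of_nat (card (along_v \<tau>)) :: complex"
  shows total_denominator: "2 * (p + q) - 1 \<noteq> 0"
    and total_eq: "p * (2 * state_sum \<tau> + 1) + q * (2 * state_sum \<tau> - 1) = state_sum \<tau>"
    and total_u: "2 * state_sum \<tau> + 1 \<noteq> 0" and total_v: "2 * state_sum \<tau> - 1 \<noteq> 0"
proof -
  have odd: "2 * (of_nat n :: complex) \<noteq> 1" "4 * (of_nat n :: complex) \<noteq> 1" for n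
  proof -
    have "of_nat (2 * n) \<noteq> (of_nat 1 :: complex)" "of_nat (4 * n) \<noteq> (of_nat 1 :: complex)"
      unfolding of_nat_eq_iff by presburger+
    then show "2 * (of_nat n :: complex) \<noteq> 1" "4 * (of_nat n :: complex) \<noteq> 1" by simp_all
  qed
  show d: "2 * (p + q) - 1 \<noteq> 0"
    using odd(1)[of "card (along_u \<tau>) + card (along_v \<tau>)"] by (simp add: p_def q_def)
  have t: "(2 * (p + q) - 1) * state_sum \<tau> = q - p"
    using d unfolding state_sum_def p_def[symmetric] q_def[symmetric] by simp
  then show "p * (2 * state_sum \<tau> + 1) + q * (2 * state_sum \<tau> - 1) = state_sum \<tau>"
    by (simp add: algebra_simps)
  have "(2 * (p + q) - 1) * (2 * state_sum \<tau> + 1) =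
      2 * ((2 * (p + q) - 1) * state_sum \<tau>) + (2 * (p + q) - 1)" by (simp add: algebra_simps)
  then have "(2 * (p + q) - 1) * (2 * state_sum \<tau> + 1) = 4 * q - 1"
    unfolding t by simp
  moreover have "4 * q - 1 \<noteq> 0" using odd(2) by (simp add: q_def)
  ultimately show "2 * state_sum \<tau> + 1 \<noteq> 0" by (metis mult_zero_right)
  have "(2 * (p + q) - 1) * (2 * state_sum \<tau> - 1) =
      2 * ((2 * (p + q) - 1) * state_sum \<tau>) - (2 * (p + q) - 1)" by (simp add: algebra_simps)
  then have "(2 * (p + q) - 1) * (2 * state_sum \<tau> - 1) = 1 - 4 * p"
    unfolding t by simp
  moreover have "1 - 4 * p \<noteq> 0" using odd(2) by (simp add: p_def eq_commute[of 1])
  ultimately show "2 * state_sum \<tau> - 1 \<noteq> 0" by (metis mult_zero_right)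
qed

lemma sum_over_state:
  fixes \<tau> :: "'m::finite state" and x y :: complex
  shows "(\<Sum>k\<in>UNIV. case \<tau> k of None \<Rightarrow> 0 | Some (False, b) \<Rightarrow> x | Some (True, b) \<Rightarrow> y) =
    of_nat (card (along_u \<tau>)) * x + of_nat (card (along_v \<tau>)) * y"
proof -
  have "(\<Sum>k\<in>UNIV. case \<tau> k of None \<Rightarrow> 0 | Some (False, b) \<Rightarrow> x | Some (True, b) \<Rightarrow> y) =
      (\<Sum>k\<in>UNIV. (if k \<in> along_u \<tau> then x else 0) + (if k \<in> along_v \<tau> then y else 0))"
    by (rule sum.cong) (auto simp: along_u_def along_v_def split: option.split bool.split)
  then show ?thesis by (simp add: sum.distrib flip: sum.inter_filter)
qed

lemma intensity_state:
  "intensity (state_u \<tau>) (state_v \<tau>) k =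
    (case \<tau> k of None \<Rightarrow> 0 | Some (False, b) \<Rightarrow> 2 * state_sum \<tau> + 1 | Some (True, b) \<Rightarrow> 2 * state_sum \<tau> - 1)"
  by (auto simp: intensity_def state_u_def state_v_def power_mult_distrib split: option.split bool.split)

lemma sum_intensity_state: "(\<Sum>k\<in>UNIV. intensity (state_u \<tau>) (state_v \<tau>) k) = state_sum \<tau>"
  unfolding intensity_state sum_over_state by (rule total_eq)

lemma state_solution:
  "block_p base_block (state_u \<tau>) (state_v \<tau>) k = 0"
  "block_q base_block (state_u \<tau>) (state_v \<tau>) k = 0"
  unfolding base_block_p base_block_q sum_intensity_state intensity_state
  by (auto simp: state_u_def state_v_def split: option.split bool.split)

lemma state_inj:
  assumes "state_u \<tau> = state_u \<tau>'" "state_v \<tau> = state_v \<tau>'"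
  shows "\<tau> = \<tau>'"
proof
  fix k
  have t: "state_sum \<tau> = state_sum \<tau>'" using assms by (simp flip: sum_intensity_state)
  have "csqrt (2 * state_sum \<tau>' + 1) \<noteq> 0" "csqrt (2 * state_sum \<tau>' - 1) \<noteq> 0"
    using total_u[of \<tau>'] total_v[of \<tau>'] by simp_all
  moreover have "state_u \<tau> $ k = state_u \<tau>' $ k" "state_v \<tau> $ k = state_v \<tau>' $ k"
    using assms by simp_all
  ultimately show "\<tau> k = \<tau>' k"
    by (auto simp: state_u_def state_v_def t split: option.splits bool.splits if_splits)
qed

text \<open>
  In a direction annihilated by the derivative, the components transversal to the state vanish, as their
  coefficients $2S+1$, $2S-1$ or $\pm 2$ do not vanish. Along each nonzero frequency the intensity changes
  by $2\,dS$. Summation gives $dS = 2(p+q)\,dS$, so $dS = 0$ by parity and the remaining components vanish.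
\<close>

lemma state_nondegenerate:
  fixes \<tau> :: "'m::finite state" and h g :: "complex ^ 'm"
  defines "u s \<equiv> (\<chi> k. state_u \<tau> $ k + s * h $ k)" and "v s \<equiv> (\<chi> k. state_v \<tau> $ k + s * g $ k)"
  assumes p: "\<And>k. ((\<lambda>s. block_p base_block (u s) (v s) k) has_field_derivative 0) (at 0)"
    and q: "\<And>k. ((\<lambda>s. block_q base_block (u s) (v s) k) has_field_derivative 0) (at 0)"
  shows "h = 0" "g = 0"
proof -
  define da where "da k = 2 * state_u \<tau> $ k * h $ k + 2 * state_v \<tau> $ k * g $ k" for k
  define dS where "dS = (\<Sum>k\<in>UNIV. da k)"
  have intensity: "((\<lambda>s. intensity (u s) (v s) k) has_field_derivative da k) (at 0)" for k
    unfolding intensity_def u_def v_def da_def by (auto intro!: derivative_eq_intros simp: algebra_simps)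
  have S: "((\<lambda>s. \<Sum>k\<in>UNIV. intensity (u s) (v s) k) has_field_derivative dS) (at 0)"
    unfolding dS_def by (intro DERIV_sum intensity)
  have at0: "u 0 = state_u \<tau>" "v 0 = state_v \<tau>" by (simp_all add: u_def v_def vec_eq_iff)
  have du: "((\<lambda>s. u s $ k) has_field_derivative h $ k) (at 0)" for k
    unfolding u_def by (auto intro!: derivative_eq_intros)
  have dv: "((\<lambda>s. v s $ k) has_field_derivative g $ k) (at 0)" for k
    unfolding v_def by (auto intro!: derivative_eq_intros)
  let ?s = "\<lambda>k. intensity (state_u \<tau>) (state_v \<tau>) k"
  have "((\<lambda>s. block_p base_block (u s) (v s) k) has_field_derivative
      h $ k * (1 + 2 * state_sum \<tau> - ?s k) + state_u \<tau> $ k * (2 * dS - da k)) (at 0)" for k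
    unfolding base_block_p
    by (rule derivative_eq_intros du intensity S refl)+ (simp add: at0 sum_intensity_state)
  then have P: "h $ k * (1 + 2 * state_sum \<tau> - ?s k) + state_u \<tau> $ k * (2 * dS - da k) = 0" for k
    using DERIV_unique p by blast
  have "((\<lambda>s. block_q base_block (u s) (v s) k) has_field_derivative
      g $ k * (2 * state_sum \<tau> - 1 - ?s k) + state_v \<tau> $ k * (2 * dS - da k)) (at 0)" for k
    unfolding base_block_q
    by (rule derivative_eq_intros dv intensity S refl)+ (simp add: at0 sum_intensity_state)
  then have Q: "g $ k * (2 * state_sum \<tau> - 1 - ?s k) + state_v \<tau> $ k * (2 * dS - da k) = 0" for k
    using DERIV_unique q by blast
  have nz: "csqrt (2 * state_sum \<tau> + 1) \<noteq> 0" "csqrt (2 * state_sum \<tau> - 1) \<noteq> 0"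
    "2 * state_sum \<tau> + 1 \<noteq> 0" "1 + 2 * state_sum \<tau> \<noteq> 0" "2 * state_sum \<tau> - 1 \<noteq> 0"
    using total_u[of \<tau>] total_v[of \<tau>] by (simp_all add: add.commute)
  have none: "h $ k = 0 \<and> g $ k = 0" if "\<tau> k = None" for k
    using P[of k, unfolded intensity_state] Q[of k, unfolded intensity_state] nz that by (simp add: state_u_nth state_v_nth)
  have u: "g $ k = 0 \<and> da k = 2 * dS" if "\<tau> k = Some (False, b)" for k b
    using P[of k, unfolded intensity_state] Q[of k, unfolded intensity_state] nz that by (auto simp: state_u_nth state_v_nth split: if_splits)
  have v: "h $ k = 0 \<and> da k = 2 * dS" if "\<tau> k = Some (True, b)" for k b
    using P[of k, unfolded intensity_state] Q[of k, unfolded intensity_state] nz that by (auto simp: state_u_nth state_v_nth split: if_splits)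
  have "da k = (case \<tau> k of None \<Rightarrow> 0 | Some (False, b) \<Rightarrow> 2 * dS | Some (True, b) \<Rightarrow> 2 * dS)" for k
    using none[of k] u[of k] v[of k] by (auto simp: da_def split: option.split bool.split)
  then have "(\<Sum>k\<in>UNIV. da k) =
      of_nat (card (along_u \<tau>)) * (2 * dS) + of_nat (card (along_v \<tau>)) * (2 * dS)"
    by (simp only: sum_over_state)
  then have "dS = of_nat (card (along_u \<tau>)) * (2 * dS) + of_nat (card (along_v \<tau>)) * (2 * dS)"
    unfolding dS_def[symmetric] .
  then have "(2 * (of_nat (card (along_u \<tau>)) + of_nat (card (along_v \<tau>))) - 1) * dS = 0"
    by (simp add: algebra_simps)
  then have "dS = 0" using total_denominator[of \<tau>] by simp
  have "h $ k = 0 \<and> g $ k = 0" for k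
  proof (cases "\<tau> k")
    case None
    then show ?thesis by (rule none)
  next
    case (Some db)
    then obtain d b where db: "\<tau> k = Some (d, b)" by (cases db) auto
    show ?thesis
    proof (cases d)
      case True
      then show ?thesis using v[of k b] db \<open>dS = 0\<close> nz by (simp add: da_def state_v_nth state_u_nth split: if_splits)
    next
      case False
      then show ?thesis using u[of k b] db \<open>dS = 0\<close> nz by (simp add: da_def state_v_nth state_u_nth split: if_splits)
    qed
  qed
  then show "h = 0" "g = 0" by (simp_all add: vec_eq_iff)
qed

section \<open>Coupled blocks\<close>

instance coeff :: (finite, finite, finite) finite
proof
  have "b \<in> range (\<lambda>(i, s). Block i s) \<union> range Coupling" for b :: "('a, 'b, 'c) coeff"
    by (cases b) (auto simp: image_iff)
  then have "(UNIV :: ('a, 'b, 'c) coeff set) \<subseteq> range (\<lambda>(i, s). Block i s) \<union> range Coupling"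
    by blast
  then show "finite (UNIV :: ('a, 'b, 'c) coeff set)" by (rule finite_subset) simp
qed

text \<open>
  The constant terms enter the equations additively. Reading the entries of a coefficient vector at the
  places of the constant terms as values of the unknowns turns the solution set into a fibre of a
  polynomial self-map of the coefficient space, which keeps all other coefficients.
\<close>

definition slot_u :: "(('n::finite, 'm::finite, 'c) coeff \<Rightarrow> complex) \<Rightarrow> complex ^ 'm ^ 'n" where
  "slot_u w = (\<chi> i k. w (Block i (A0 k)))"

definition slot_v :: "(('n::finite, 'm::finite, 'c) coeff \<Rightarrow> complex) \<Rightarrow> complex ^ 'm ^ 'n" where
  "slot_v w = (\<chi> i k. w (Block i (B0 k)))"

lemma slot_nth [simp]:
  "slot_u w $ i $ k = w (Block i (A0 k))" "slot_v w $ i $ k = w (Block i (B0 k))"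
  by (simp_all add: slot_u_def slot_v_def)

text \<open>
  The equations change by the difference of the constant terms if only these are changed.
\<close>

lemma block_p_shift:
  assumes "a (A1 k) = a' (A1 k)" "a (C k) = a' (C k)" "a (D k) = a' (D k)"
  shows "block_p a u v k - a (A0 k) = block_p a' u v k - a' (A0 k)"
  using assms by (simp add: block_p_def)

lemma block_q_shift:
  assumes "a (B1 k) = a' (B1 k)" "a (C k) = a' (C k)" "a (D k) = a' (D k)"
  shows "block_q a u v k - a (B0 k) = block_q a' u v k - a' (B0 k)"
  using assms by (simp add: block_q_def)

definition agree_off_slots ::
  "(('n, 'm, 'c) coeff \<Rightarrow> complex) \<Rightarrow> (('n, 'm, 'c) coeff \<Rightarrow> complex) \<Rightarrow> bool" where
  "agree_off_slots w x \<longleftrightarrow> (\<forall>s. (\<forall>i k. s \<noteq> Block i (A0 k) \<and> s \<noteq> Block i (B0 k)) \<longrightarrow> w s = x s)"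

lemma agree_off_slotsD:
  assumes "agree_off_slots w x"
  shows "w (Block i (A1 k)) = x (Block i (A1 k))" "w (Block i (B1 k)) = x (Block i (B1 k))"
    "w (Block i (C k)) = x (Block i (C k))" "w (Block i (D k)) = x (Block i (D k))"
    "w (Coupling c) = x (Coupling c)"
  using assms by (auto simp: agree_off_slots_def)

lemma agree_off_slots_eqI:
  assumes "agree_off_slots w x" "agree_off_slots w' x" "slot_u w = slot_u w'" "slot_v w = slot_v w'"
  shows "w = w'"
proof
  fix s
  have u: "w (Block i (A0 k)) = w' (Block i (A0 k))" and v: "w (Block i (B0 k)) = w' (Block i (B0 k))"
    for i k using assms(3,4) by (simp_all add: vec_eq_iff)
  show "w s = w' s"
  proof (cases "\<exists>i k. s = Block i (A0 k) \<or> s = Block i (B0 k)")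
    case True
    then show ?thesis using u v by blast
  next
    case False
    then show ?thesis using assms(1,2) by (simp add: agree_off_slots_def)
  qed
qed

text \<open>
  The map \<open>\<Phi>\<close> keeps the coefficients other than the constant terms and sends the unknowns to those
  constant terms for which they solve the system. Without coupling and with the special block for each
  resonator, the fibre contains one point for each choice of states. The coupling terms vanish identically
  when all coupling coefficients are zero, so they do not affect the derivative in the directions that
  remain after the kept coefficients have been dealt with.
\<close>

theorem for_general_coupled:
  fixes cp cq :: "('c::finite \<Rightarrow> complex) \<Rightarrow> complex ^ 'm::finite ^ 'n::finite \<Rightarrow>
      complex ^ 'm ^ 'n \<Rightarrow> 'n \<Rightarrow> 'm \<Rightarrow> complex"
  assumes poly:
      "\<And>i k. polyfun (\<lambda>w :: ('n, 'm, 'c) coeff \<Rightarrow> complex. cp (\<lambda>c. w (Coupling c)) (slot_u w) (slot_v w) i k)"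
      "\<And>i k. polyfun (\<lambda>w :: ('n, 'm, 'c) coeff \<Rightarrow> complex. cq (\<lambda>c. w (Coupling c)) (slot_u w) (slot_v w) i k)"
    and uncoupled: "\<And>u v i k. cp (\<lambda>_. 0) u v i k = 0" "\<And>u v i k. cq (\<lambda>_. 0) u v i k = 0"
  shows "for_general (\<lambda>x :: ('n, 'm, 'c) coeff \<Rightarrow> complex.
    at_least_elements (5 ^ (CARD('m) * CARD('n))) {(u, v). \<forall>i k.
      block_p (\<lambda>s. x (Block i s)) (u $ i) (v $ i) k + cp (\<lambda>c. x (Coupling c)) u v i k = 0 \<and>
      block_q (\<lambda>s. x (Block i s)) (u $ i) (v $ i) k + cq (\<lambda>c. x (Coupling c)) u v i k = 0})"
proof -
  define cos_eq where "cos_eq x w i k = block_p (\<lambda>s. x (Block i s)) (slot_u w $ i) (slot_v w $ i) k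
      + cp (\<lambda>c. x (Coupling c)) (slot_u w) (slot_v w) i k"
    for x w :: "('n, 'm, 'c) coeff \<Rightarrow> complex" and i k
  define sin_eq where "sin_eq x w i k = block_q (\<lambda>s. x (Block i s)) (slot_u w $ i) (slot_v w $ i) k
      + cq (\<lambda>c. x (Coupling c)) (slot_u w) (slot_v w) i k"
    for x w :: "('n, 'm, 'c) coeff \<Rightarrow> complex" and i k
  define \<Phi> :: "(('n, 'm, 'c) coeff \<Rightarrow> complex) \<Rightarrow> ('n, 'm, 'c) coeff \<Rightarrow> complex" where
    "\<Phi> w s = (case s of
        Block i (A0 k) \<Rightarrow> w (Block i (A0 k)) - cos_eq w w i k
      | Block i (B0 k) \<Rightarrow> w (Block i (B0 k)) - sin_eq w w i k
      | _ \<Rightarrow> w s)" for w s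
  have polyfun_\<Phi>: "polyfun (\<lambda>w. \<Phi> w s)" for s
  proof -
    have "polyfun (\<lambda>w. cos_eq w w i k)" "polyfun (\<lambda>w. sin_eq w w i k)" for i k
      unfolding cos_eq_def sin_eq_def block_p_def block_q_def slot_nth
      by (intro polyfun_intros poly)+
    then show ?thesis
      unfolding \<Phi>_def
      by (cases s; simp; cases "case s of Block i b \<Rightarrow> b")
        (auto intro!: polyfun_intros split: block_coeff.split)
  qed
  have \<Phi>_slots: "\<Phi> w (Block i (A0 k)) = x (Block i (A0 k)) - cos_eq x w i k"
    "\<Phi> w (Block i (B0 k)) = x (Block i (B0 k)) - sin_eq x w i k" if "agree_off_slots w x" for w x i k
    using agree_off_slotsD[OF that]
      block_p_shift[of "\<lambda>s. w (Block i s)" k "\<lambda>s. x (Block i s)" "slot_u w $ i" "slot_v w $ i"]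
      block_q_shift[of "\<lambda>s. w (Block i s)" k "\<lambda>s. x (Block i s)" "slot_u w $ i" "slot_v w $ i"]
    by (simp_all add: \<Phi>_def cos_eq_def sin_eq_def algebra_simps)
  have \<Phi>_other: "\<Phi> w s = w s" if "\<And>i k. s \<noteq> Block i (A0 k)" "\<And>i k. s \<noteq> Block i (B0 k)" for w s
    using that by (auto simp: \<Phi>_def split: coeff.split block_coeff.split)

  define x0 :: "('n, 'm, 'c) coeff \<Rightarrow> complex" where
    "x0 s = (case s of Block i b \<Rightarrow> base_block b | Coupling c \<Rightarrow> 0)" for s
  define W :: "('n \<Rightarrow> 'm state) \<Rightarrow> ('n, 'm, 'c) coeff \<Rightarrow> complex" where
    "W \<sigma> s = (case s of
        Block i (A0 k) \<Rightarrow> state_u (\<sigma> i) $ k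
      | Block i (B0 k) \<Rightarrow> state_v (\<sigma> i) $ k
      | _ \<Rightarrow> x0 s)" for \<sigma> s
  have x0: "(\<lambda>s. x0 (Block i s)) = base_block" "(\<lambda>c. x0 (Coupling c)) = (\<lambda>_. 0)" for i
    by (simp_all add: x0_def)
  have W_slots: "W \<sigma> (Block i (A0 k)) = state_u (\<sigma> i) $ k" "W \<sigma> (Block i (B0 k)) = state_v (\<sigma> i) $ k"
    for \<sigma> i k by (simp_all add: W_def)
  have W_agrees: "agree_off_slots (W \<sigma>) x0" for \<sigma>
    unfolding agree_off_slots_def by (auto simp: W_def split: coeff.split block_coeff.split)
  have \<Phi>_W: "\<Phi> (W \<sigma>) = x0" for \<sigma>
  proof
    fix s
    have "slot_u (W \<sigma>) $ i = state_u (\<sigma> i)" "slot_v (W \<sigma>) $ i = state_v (\<sigma> i)" for i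
      by (simp_all add: vec_eq_iff W_slots)
    then have "cos_eq x0 (W \<sigma>) i k = 0" "sin_eq x0 (W \<sigma>) i k = 0" for i k
      by (simp_all add: cos_eq_def sin_eq_def x0 uncoupled state_solution)
    then have "\<Phi> (W \<sigma>) (Block i (A0 k)) = x0 (Block i (A0 k))"
      "\<Phi> (W \<sigma>) (Block i (B0 k)) = x0 (Block i (B0 k))" for i k
      using \<Phi>_slots[OF W_agrees] by simp_all
    moreover have "\<Phi> (W \<sigma>) s = x0 s" if "\<And>i k. s \<noteq> Block i (A0 k)" "\<And>i k. s \<noteq> Block i (B0 k)"
      using \<Phi>_other[OF that] W_agrees that by (simp add: agree_off_slots_def)
    ultimately show "\<Phi> (W \<sigma>) s = x0 s" by blast
  qed
  have nondegenerate: "h = (\<lambda>_. 0)"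
    if h: "\<And>s. ((\<lambda>t. \<Phi> (\<lambda>j. W \<sigma> j + t * h j) s) has_field_derivative 0) (at 0)" for \<sigma> h
  proof -
    have other: "h s = 0" if s: "\<And>i k. s \<noteq> Block i (A0 k)" "\<And>i k. s \<noteq> Block i (B0 k)" for s
    proof -
      have "((\<lambda>t. W \<sigma> s + t * h s) has_field_derivative 0) (at 0)"
        using h[of s] unfolding \<Phi>_other[OF s] .
      moreover have "((\<lambda>t. W \<sigma> s + t * h s) has_field_derivative h s) (at 0)"
        by (auto intro!: derivative_eq_intros)
      ultimately show ?thesis using DERIV_unique by blast
    qed
    have agree: "agree_off_slots (\<lambda>j. W \<sigma> j + t * h j) x0" for t
      using W_agrees other by (simp add: agree_off_slots_def)
    have "slot_u h $ i = 0 \<and> slot_v h $ i = 0" for i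
    proof -
      let ?u = "\<lambda>t. \<chi> k. state_u (\<sigma> i) $ k + t * slot_u h $ i $ k"
      let ?v = "\<lambda>t. \<chi> k. state_v (\<sigma> i) $ k + t * slot_v h $ i $ k"
      have uv: "slot_u (\<lambda>j. W \<sigma> j + t * h j) $ i = ?u t" "slot_v (\<lambda>j. W \<sigma> j + t * h j) $ i = ?v t" for t
        by (simp_all add: vec_eq_iff W_slots)
      have "((\<lambda>t. - block_p base_block (?u t) (?v t) k) has_field_derivative 0) (at 0)"
        "((\<lambda>t. - block_q base_block (?u t) (?v t) k) has_field_derivative 0) (at 0)" for k
        using h[of "Block i (A0 k)"] h[of "Block i (B0 k)"]
        unfolding \<Phi>_slots[OF agree] cos_eq_def sin_eq_def uv x0 uncoupled
        by (simp_all add: x0_def)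
      then have d: "((\<lambda>t. block_p base_block (?u t) (?v t) k) has_field_derivative 0) (at 0)"
        "((\<lambda>t. block_q base_block (?u t) (?v t) k) has_field_derivative 0) (at 0)" for k
        using DERIV_minus by fastforce+
      from state_nondegenerate[OF d] show ?thesis by blast
    qed
    then have "h (Block i (A0 k)) = 0" "h (Block i (B0 k)) = 0" for i k
      by (simp_all add: vec_eq_iff)
    then have "h s = 0" for s using other[of s] by blast
    then show ?thesis by (rule ext)
  qed
  have inj: "inj W"
  proof (rule injI)
    fix \<sigma> \<sigma>' :: "'n \<Rightarrow> 'm state" assume eq: "W \<sigma> = W \<sigma>'"
    have "state_u (\<sigma> i) = state_u (\<sigma>' i)" "state_v (\<sigma> i) = state_v (\<sigma>' i)" for i
      using fun_cong[OF eq] by (simp_all add: vec_eq_iff flip: W_slots)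
    then show "\<sigma> = \<sigma>'" using state_inj by blast
  qed
  have card: "card (range W) = 5 ^ (CARD('m) * CARD('n))"
    using inj by (simp add: card_image card_fun card_option card_prod power_mult)
  have "for_general (\<lambda>x. at_least_elements (card (range W)) {w. \<Phi> w = x})"
  proof (rule for_general_nondegenerate[of \<Phi> "range W" x0])
    fix z h assume "z \<in> range W"
      and h: "\<And>i. ((\<lambda>s. \<Phi> (\<lambda>j. z j + s * h j) i) has_field_derivative 0) (at 0)"
    then obtain \<sigma> where "z = W \<sigma>" by blast
    show "h = (\<lambda>_. 0)" by (rule nondegenerate) (fact h[unfolded \<open>z = W \<sigma>\<close>])
  qed (use polyfun_\<Phi> \<Phi>_W in auto)
  then show ?thesis
    unfolding card
  proof (rule for_general_mono)
    fix x assume large: "at_least_elements (5 ^ (CARD('m) * CARD('n))) {w. \<Phi> w = x}"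
    have agree: "agree_off_slots w x" if "\<Phi> w = x" for w
      using \<Phi>_other that by (auto simp: agree_off_slots_def)
    show "at_least_elements (5 ^ (CARD('m) * CARD('n))) {(u, v). \<forall>i k.
      block_p (\<lambda>s. x (Block i s)) (u $ i) (v $ i) k + cp (\<lambda>c. x (Coupling c)) u v i k = 0 \<and>
      block_q (\<lambda>s. x (Block i s)) (u $ i) (v $ i) k + cq (\<lambda>c. x (Coupling c)) u v i k = 0}"
    proof (rule at_least_elements_image[OF large])
      show "inj_on (\<lambda>w. (slot_u w, slot_v w)) {w. \<Phi> w = x}"
      proof (rule inj_onI)
        fix w w' assume "w \<in> {w. \<Phi> w = x}" "w' \<in> {w. \<Phi> w = x}"
          and "(slot_u w, slot_v w) = (slot_u w', slot_v w')"
        then show "w = w'" by (intro agree_off_slots_eqI[of w x w'] agree) simp_all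
      qed
      have "cos_eq x w i k = 0" "sin_eq x w i k = 0" if "\<Phi> w = x" for w i k
        using \<Phi>_slots[OF agree[OF that], of i k] that by simp_all
      then show "(\<lambda>w. (slot_u w, slot_v w)) ` {w. \<Phi> w = x} \<subseteq> {(u, v). \<forall>i k.
          block_p (\<lambda>s. x (Block i s)) (u $ i) (v $ i) k + cp (\<lambda>c. x (Coupling c)) u v i k = 0 \<and>
          block_q (\<lambda>s. x (Block i s)) (u $ i) (v $ i) k + cq (\<lambda>c. x (Coupling c)) u v i k = 0}"
        unfolding cos_eq_def sin_eq_def by auto
    qed
  qed
qed

instance interaction :: (finite) finite
proof
  have "b \<in> range (\<lambda>(i, l). J i l)" for b :: "'a interaction"
    by (cases b) (auto simp: image_iff)
  then have "(UNIV :: 'a interaction set) \<subseteq> range (\<lambda>(i, l). J i l)" by blast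
  then show "finite (UNIV :: 'a interaction set)" by (rule finite_subset) simp
qed

instance linear_coupling :: (finite, finite) finite
proof
  let ?c = "\<lambda>f. range (\<lambda>(i, k, l, m). f i k l m :: ('a, 'b) linear_coupling)"
  have "b \<in> ?c PU \<union> ?c PV \<union> ?c QU \<union> ?c QV" for b
    by (cases b) (auto simp: image_iff)
  then have "(UNIV :: ('a, 'b) linear_coupling set) \<subseteq> ?c PU \<union> ?c PV \<union> ?c QU \<union> ?c QV" by blast
  then show "finite (UNIV :: ('a, 'b) linear_coupling set)" by (rule finite_subset) simp
qed

lemma for_general_resonators:
  "for_general (\<lambda>x :: ('n::finite, 'm::finite, 'n interaction) coeff \<Rightarrow> complex.
     at_least_elements (5 ^ (CARD('m) * CARD('n))) (resonator_solutions x))"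
  unfolding resonator_solutions_def
  by (rule for_general_coupled[where
        cp = "\<lambda>a u v i k. \<Sum>l\<in>UNIV - {i}. a (J i l) * u $ l $ k" and
        cq = "\<lambda>a u v i k. \<Sum>l\<in>UNIV - {i}. a (J i l) * v $ l $ k"])
    (unfold slot_nth, (intro polyfun_intros)+, simp_all)

lemma for_general_linearly_coupled:
  "for_general (\<lambda>x :: ('n::finite, 'm::finite, ('n, 'm) linear_coupling) coeff \<Rightarrow> complex.
     at_least_elements (5 ^ (CARD('m) * CARD('n))) (linearly_coupled_solutions x))"
  unfolding linearly_coupled_solutions_def
  by (rule for_general_coupled[where
        cp = "\<lambda>a u v i k. \<Sum>l\<in>UNIV - {i}. \<Sum>m\<in>UNIV.
            a (PU i k l m) * u $ l $ m + a (PV i k l m) * v $ l $ m" and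
        cq = "\<lambda>a u v i k. \<Sum>l\<in>UNIV - {i}. \<Sum>m\<in>UNIV.
            a (QU i k l m) * u $ l $ m + a (QV i k l m) * v $ l $ m"])
    (unfold slot_nth, (intro polyfun_intros)+, simp_all)

section \<open>Two quintics in the plane\<close>

text \<open>
  A linear functional supported on finitely many points and vanishing on all monomials vanishes on the
  polynomial that is zero at all these points but one.
\<close>

lemma monomials_separate_points:
  fixes Y :: "('i::finite \<Rightarrow> complex) set"
  assumes "finite Y" "\<And>e. (\<Sum>z\<in>Y. w z * mon e z) = 0" "q \<in> Y"
  shows "w q = 0"
proof -
  define i where "i z = (SOME i. z i \<noteq> q i)" for z
  have i: "z (i z) \<noteq> q (i z)" if "z \<noteq> q" for z
    unfolding i_def by (rule someI_ex) (use that in \<open>auto simp: fun_eq_iff\<close>)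
  define f where "f x = (\<Prod>z\<in>Y - {q}. x (i z) - z (i z))" for x
  have "polyfun f" unfolding f_def[abs_def] by (intro polyfun_intros)
  then obtain n c where c: "\<And>x. f x = (\<Sum>e\<in>exponents_upto n. c e * mon e x)"
    using polyfun_boxed unfolding boxed_def by blast
  have "(\<Sum>z\<in>Y. w z * f z) = (\<Sum>e\<in>exponents_upto n. c e * (\<Sum>z\<in>Y. w z * mon e z))"
    unfolding c sum_distrib_left by (subst sum.swap) (simp add: mult_ac)
  then have "(\<Sum>z\<in>Y. w z * f z) = 0" using assms(2) by simp
  moreover have "f z = 0" if "z \<in> Y - {q}" for z
    unfolding f_def using assms(1) that by (intro prod_zero) auto
  ultimately have "w q * f q = 0"
    using assms(1,3) by (simp add: sum.remove[of Y q])
  moreover have "f q \<noteq> 0"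
    using i assms(1) by (force simp: f_def)
  ultimately show ?thesis by simp
qed

lemma poly_eq_sum_upto:
  fixes p :: "'a::comm_semiring_1 poly"
  assumes "degree p \<le> n"
  shows "poly p x = (\<Sum>m\<le>n. coeff p m * x ^ m)"
  unfolding poly_altdef by (rule sum.mono_neutral_left) (use assms in \<open>auto simp: coeff_eq_0\<close>)

lemma sum_quintic:
  fixes W f g :: "'z \<Rightarrow> complex"
  assumes quintic: "\<And>z. z \<in> Y \<Longrightarrow> f z ^ 5 = 2 * f z ^ 4 * g z + (2 * g z - f z) * poly p (f z) + poly r (f z)"
    and deg: "degree p \<le> 3" "degree r \<le> 4"
    and zero: "\<And>m. m \<le> 3 \<Longrightarrow> (\<Sum>z\<in>Y. W z * (f z ^ m * g z)) = 0" "\<And>m. m \<le> 4 \<Longrightarrow> (\<Sum>z\<in>Y. W z * f z ^ m) = 0"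
  shows "(\<Sum>z\<in>Y. W z * f z ^ 5) = 2 * (\<Sum>z\<in>Y. W z * (f z ^ 4 * g z))"
proof -
  have "(\<Sum>z\<in>Y. W z * ((2 * g z - f z) * poly p (f z))) =
      (\<Sum>z\<in>Y. \<Sum>m\<le>3. coeff p m * (2 * (W z * (f z ^ m * g z)) - W z * f z ^ Suc m))"
    by (simp add: poly_eq_sum_upto[OF deg(1)] sum_distrib_left sum_distrib_right algebra_simps)
  also have "\<dots> = (\<Sum>m\<le>3. coeff p m *
      (2 * (\<Sum>z\<in>Y. W z * (f z ^ m * g z)) - (\<Sum>z\<in>Y. W z * f z ^ Suc m)))"
    by (subst sum.swap) (simp add: sum_subtractf del: power_Suc flip: sum_distrib_left)
  also have "\<dots> = 0"
    using zero(1) zero(2)[of "Suc m" for m] by (intro sum.neutral) (auto simp del: power_Suc)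
  finally have p: "(\<Sum>z\<in>Y. W z * ((2 * g z - f z) * poly p (f z))) = 0" .
  have "(\<Sum>z\<in>Y. W z * poly r (f z)) = (\<Sum>m\<le>4. coeff r m * (\<Sum>z\<in>Y. W z * f z ^ m))"
    unfolding poly_eq_sum_upto[OF deg(2)] sum_distrib_left by (subst sum.swap) (simp add: mult_ac)
  also have "\<dots> = 0" using zero(2) by simp
  finally have r: "(\<Sum>z\<in>Y. W z * poly r (f z)) = 0" .
  have "(\<Sum>z\<in>Y. W z * f z ^ 5) = (\<Sum>z\<in>Y. 2 * (W z * (f z ^ 4 * g z))
      + W z * ((2 * g z - f z) * poly p (f z)) + W z * poly r (f z))"
    by (rule sum.cong) (simp_all add: quintic algebra_simps)
  then show ?thesis by (simp add: sum.distrib sum_distrib_left p r)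
qed

text \<open>
  Bezout's bound for two quintics without common zeros at infinity, in the form needed here. The leading
  forms $x^4(2y-x)$ and $y^4(2x-y)$ reduce every monomial, modulo lower degree, to one with both exponents
  at most $4$: exponents move by $x^5 \to 2x^4y$ and $y^5 \to 2xy^4$ towards $x^4 y^j$, and
  $x^4y^5 \to 2x^5y^4 \to 4x^4y^5$ shows that these reduce to lower degree as soon as $j \ge 5$.
  Given $26$ points there would be a nonzero functional supported on them that vanishes on the $25$ monomials
  of the box, hence on all monomials.
\<close>

lemma two_quintics:
  fixes X :: "(bool \<Rightarrow> complex) set"
  assumes quintic: "\<And>z b. z \<in> X \<Longrightarrow> z b ^ 5 = 2 * z b ^ 4 * z (\<not> b)
      + (2 * z (\<not> b) - z b) * poly (p b) (z b) + poly (r b) (z b)"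
    and deg: "\<And>b. degree (p b) \<le> 3" "\<And>b. degree (r b) \<le> 4"
  shows "finite X \<and> card X \<le> 25"
proof (rule ccontr)
  assume large: "\<not> (finite X \<and> card X \<le> 25)"
  have "\<exists>Y. finite Y \<and> card Y = 26 \<and> Y \<subseteq> X"
  proof (cases "finite X")
    case True
    then have "26 \<le> card X" using large by simp
    then show ?thesis by (meson obtain_subset_with_card_n)
  next
    case False
    then show ?thesis by (rule infinite_arbitrarily_large)
  qed
  then obtain Y where Y: "Y \<subseteq> X" "finite Y" "card Y = 26" by blast
  have "\<exists>w. (\<exists>z\<in>Y. w z \<noteq> 0) \<and> (\<forall>e\<in>exponents_upto 4. (\<Sum>z\<in>Y. mon e z * w z) = 0)"
    using Y by (intro underdetermined_system) (auto simp: card_exponents_upto)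
  then obtain w q where q: "q \<in> Y" "w q \<noteq> 0"
    and w: "\<And>e. e \<in> exponents_upto 4 \<Longrightarrow> (\<Sum>z\<in>Y. mon e z * w z) = 0" by blast
  define L where "L i j = (\<Sum>z\<in>Y. w z * (z False ^ i * z True ^ j))" for i j
  have mon: "mon e z = z False ^ e False * z True ^ e True" for e and z :: "bool \<Rightarrow> complex"
    by (simp add: mon_def UNIV_bool mult.commute)
  have box: "L i j = 0" if "i \<le> 4" "j \<le> 4" for i j
    using w[of "\<lambda>b. if b then j else i"] that by (simp add: L_def mon in_exponents_upto mult_ac)
  have "L i j = 0" for i j
  proof (induction "i + j" arbitrary: i j rule: less_induct)
    case less
    let ?n = "i + j"
    \<comment> \<open>In the current degree only the leading forms of the two equations matter.\<close>
    have x: "L (i' + 5) j' = 2 * L (i' + 4) (j' + 1)" if "i' + 5 + j' = ?n" for i' j'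
    proof -
      let ?W = "\<lambda>z. w z * (z False ^ i' * z True ^ j')"
      have "(\<Sum>z\<in>Y. ?W z * z False ^ 5) = 2 * (\<Sum>z\<in>Y. ?W z * (z False ^ 4 * z True))"
      proof (rule sum_quintic)
        show "(\<Sum>z\<in>Y. ?W z * (z False ^ m * z True)) = 0" if "m \<le> 3" for m
          using less[of "i' + m" "j' + 1"] that \<open>i' + 5 + j' = ?n\<close>
          by (simp add: L_def power_add mult_ac)
        show "(\<Sum>z\<in>Y. ?W z * z False ^ m) = 0" if "m \<le> 4" for m
          using less[of "i' + m" "j'"] that \<open>i' + 5 + j' = ?n\<close>
          by (simp add: L_def power_add mult_ac)
      qed (use quintic[of _ False] Y(1) deg in auto)
      then show ?thesis by (simp add: L_def power_add mult_ac)
    qed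
    have y: "L i' (j' + 5) = 2 * L (i' + 1) (j' + 4)" if "i' + 5 + j' = ?n" for i' j'
    proof -
      let ?W = "\<lambda>z. w z * (z False ^ i' * z True ^ j')"
      have "(\<Sum>z\<in>Y. ?W z * z True ^ 5) = 2 * (\<Sum>z\<in>Y. ?W z * (z True ^ 4 * z False))"
      proof (rule sum_quintic)
        show "(\<Sum>z\<in>Y. ?W z * (z True ^ m * z False)) = 0" if "m \<le> 3" for m
          using less[of "i' + 1" "j' + m"] that \<open>i' + 5 + j' = ?n\<close>
          by (simp add: L_def power_add mult_ac)
        show "(\<Sum>z\<in>Y. ?W z * z True ^ m) = 0" if "m \<le> 4" for m
          using less[of "i'" "j' + m"] that \<open>i' + 5 + j' = ?n\<close>
          by (simp add: L_def power_add mult_ac)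
      qed (use quintic[of _ True] Y(1) deg in auto)
      then show ?thesis by (simp add: L_def power_add mult_ac)
    qed
    have four: "L 4 (?n - 4) = 0" if "?n \<ge> 4"
    proof (cases "?n \<le> 8")
      case True
      then show ?thesis by (intro box) auto
    next
      case False
      then have "L 4 (?n - 9 + 5) = 2 * L (4 + 1) (?n - 9 + 4)" by (intro y) auto
      moreover have "L (0 + 5) (?n - 5) = 2 * L (0 + 4) (?n - 5 + 1)" using False by (intro x) auto
      moreover have "?n - 9 + 5 = ?n - 4" "?n - 9 + 4 = ?n - 5" "?n - 5 + 1 = ?n - 4" using False by auto
      ultimately have "L 4 (?n - 4) = 4 * L 4 (?n - 4)" by simp
      then show ?thesis by simp
    qed
    have high: "L (4 + m) (?n - (4 + m)) = 0" if "4 + m \<le> ?n" for m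
      using that
    proof (induction m)
      case 0
      then show ?case using four by simp
    next
      case (Suc m)
      then have "L (m + 5) (?n - (m + 5)) = 2 * L (m + 4) (?n - (m + 5) + 1)" by (intro x) auto
      moreover have "?n - (m + 5) + 1 = ?n - (4 + m)" using Suc.prems by auto
      ultimately show ?case using Suc by (simp add: add.commute)
    qed
    have low: "L (4 - m) (?n - (4 - m)) = 0" if "4 \<le> ?n" "m \<le> 4" for m
      using that(2)
    proof (induction m)
      case 0
      then show ?case using four[OF that(1)] by simp
    next
      case (Suc m)
      show ?case
      proof (cases "?n - (4 - Suc m) \<le> 4")
        case True
        then show ?thesis by (intro box) auto
      next
        case False
        then have "L (4 - Suc m) (?n - (4 - Suc m) - 5 + 5) = 2 * L (4 - Suc m + 1) (?n - (4 - Suc m) - 5 + 4)"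
          by (intro y) auto
        moreover have "?n - (4 - Suc m) - 5 + 5 = ?n - (4 - Suc m)" "4 - Suc m + 1 = 4 - m"
          "?n - (4 - Suc m) - 5 + 4 = ?n - (4 - m)" using False Suc.prems by auto
        ultimately show ?thesis using Suc by simp
      qed
    qed
    show ?case
    proof (cases "?n \<le> 4")
      case True
      then show ?thesis by (intro box) auto
    next
      case False
      then show ?thesis using high[of "i - 4"] low[of "4 - i"] by (cases "i \<le> 4") auto
    qed
  qed
  then have "(\<Sum>z\<in>Y. w z * mon e z) = 0" for e by (simp add: mon L_def)
  with Y(2) have "w q = 0" using q(1) by (rule monomials_separate_points)
  with q(2) show False by contradiction
qed

section \<open>One resonator with two frequencies\<close>

text \<open>
  With $w = 2S - s_k$ the two equations of a frequency are linear in $(u_k, v_k)$, and Cramer's rule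
  expresses $(u_k,v_k)$ by $w$ where the determinant is not zero. A solution with vanishing determinant can
  only exist if the right-hand sides vanish too, which is a condition on the coefficients alone.
\<close>

lemma block_solution:
  fixes u v :: "complex ^ 'm::finite"
  defines "w k \<equiv> 2 * (\<Sum>j\<in>UNIV. intensity u v j) - intensity u v k"
  assumes "block_p a u v k = 0" "block_q a u v k = 0"
  defines "\<Delta> \<equiv> (a (A1 k) + a (D k) * w k) * (a (B1 k) + a (D k) * w k) + (a (C k))\<^sup>2"
  shows block_solution_u: "\<Delta> * u $ k = a (C k) * a (B0 k) - a (A0 k) * (a (B1 k) + a (D k) * w k)"
    and block_solution_v: "\<Delta> * v $ k = - a (C k) * a (A0 k) - a (B0 k) * (a (A1 k) + a (D k) * w k)"
    and block_solution_intensity: "\<Delta>\<^sup>2 * intensity u v k =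
      (a (C k) * a (B0 k) - a (A0 k) * (a (B1 k) + a (D k) * w k))\<^sup>2
      + (a (C k) * a (A0 k) + a (B0 k) * (a (A1 k) + a (D k) * w k))\<^sup>2"
    and block_solution_regular:
      "a (A0 k) * a (B0 k) * (a (B1 k) - a (A1 k)) \<noteq> a (C k) * ((a (A0 k))\<^sup>2 + (a (B0 k))\<^sup>2) \<Longrightarrow> \<Delta> \<noteq> 0"
proof -
  have p: "a (A0 k) + a (A1 k) * u $ k + a (C k) * v $ k + a (D k) * u $ k * w k = 0"
    using assms(2) by (simp add: block_p_intensity w_def)
  have q: "a (B0 k) - a (C k) * u $ k + a (B1 k) * v $ k + a (D k) * v $ k * w k = 0"
    using assms(3) by (simp add: block_q_intensity w_def)
  show u: "\<Delta> * u $ k = a (C k) * a (B0 k) - a (A0 k) * (a (B1 k) + a (D k) * w k)"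
    unfolding \<Delta>_def using p q by algebra
  show v: "\<Delta> * v $ k = - a (C k) * a (A0 k) - a (B0 k) * (a (A1 k) + a (D k) * w k)"
    unfolding \<Delta>_def using p q by algebra
  have "\<Delta>\<^sup>2 * intensity u v k = (\<Delta> * u $ k)\<^sup>2 + (\<Delta> * v $ k)\<^sup>2"
    by (simp add: intensity_def power_mult_distrib distrib_left)
  then show "\<Delta>\<^sup>2 * intensity u v k =
      (a (C k) * a (B0 k) - a (A0 k) * (a (B1 k) + a (D k) * w k))\<^sup>2
      + (a (C k) * a (A0 k) + a (B0 k) * (a (A1 k) + a (D k) * w k))\<^sup>2"
    unfolding u v by algebra
  assume E: "a (A0 k) * a (B0 k) * (a (B1 k) - a (A1 k)) \<noteq> a (C k) * ((a (A0 k))\<^sup>2 + (a (B0 k))\<^sup>2)"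
  show "\<Delta> \<noteq> 0"
  proof
    assume "\<Delta> = 0"
    then have "a (C k) * a (B0 k) - a (A0 k) * (a (B1 k) + a (D k) * w k) = 0"
      "- a (C k) * a (A0 k) - a (B0 k) * (a (A1 k) + a (D k) * w k) = 0"
      using u v by simp_all
    then have "a (A0 k) * a (B0 k) * (a (B1 k) - a (A1 k)) = a (C k) * ((a (A0 k))\<^sup>2 + (a (B0 k))\<^sup>2)"
      by algebra
    with E show False by contradiction
  qed
qed

text \<open>
  Squaring and adding the formulas of Cramer's rule removes $u_k$ and $v_k$. For two frequencies
  $3s_k = 2w_{k'} - w_k$ with $k'$ the other one, so a quintic equation in $w_1$, $w_2$ results. Its leading
  form is $d^4 w_k^4 (2w_{k'} - w_k)$.
\<close>

lemma block_quintic: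
  fixes a :: "'m::finite block_coeff \<Rightarrow> complex"
  assumes "a (D k) \<noteq> 0"
  shows "\<exists>p r. degree p \<le> 3 \<and> degree r \<le> 4 \<and> (\<forall>w z s.
    ((a (A1 k) + a (D k) * w) * (a (B1 k) + a (D k) * w) + (a (C k))\<^sup>2)\<^sup>2 * s =
      (a (C k) * a (B0 k) - a (A0 k) * (a (B1 k) + a (D k) * w))\<^sup>2
      + (a (C k) * a (A0 k) + a (B0 k) * (a (A1 k) + a (D k) * w))\<^sup>2 \<longrightarrow>
    3 * s = 2 * z - w \<longrightarrow>
    w ^ 5 = 2 * w ^ 4 * z + (2 * z - w) * poly p w + poly r w)"
proof -
  define d where "d = a (D k)"
  define \<beta> where "\<beta> = (a (A1 k) + a (B1 k)) * d"
  define \<gamma> where "\<gamma> = a (A1 k) * a (B1 k) + (a (C k))\<^sup>2"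
  define f where "f = a (C k) * a (B0 k) - a (A0 k) * a (B1 k)"
  define g where "g = a (C k) * a (A0 k) + a (B0 k) * a (A1 k)"
  let ?p = "smult (1 / d ^ 4) [:\<gamma>\<^sup>2, 2 * \<beta> * \<gamma>, \<beta>\<^sup>2 + 2 * d\<^sup>2 * \<gamma>, 2 * d\<^sup>2 * \<beta>:]"
  let ?r = "smult (- 3 / d ^ 4) [:f\<^sup>2 + g\<^sup>2, 2 * g * (a (B0 k) * d) - 2 * f * (a (A0 k) * d),
      (a (A0 k) * d)\<^sup>2 + (a (B0 k) * d)\<^sup>2:]"
  have d: "d ^ 4 \<noteq> 0" using assms by (simp add: d_def)
  have "w ^ 5 = 2 * w ^ 4 * z + (2 * z - w) * poly ?p w + poly ?r w"
    if eq: "((a (A1 k) + d * w) * (a (B1 k) + d * w) + (a (C k))\<^sup>2)\<^sup>2 * s =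
      (a (C k) * a (B0 k) - a (A0 k) * (a (B1 k) + d * w))\<^sup>2
      + (a (C k) * a (A0 k) + a (B0 k) * (a (A1 k) + d * w))\<^sup>2"
      and s: "3 * s = 2 * z - w" for w z s
  proof -
    have scale: "d ^ 4 * poly (smult (c / d ^ 4) q) w = c * poly q w" for c q
      using d by simp
    have P: "d ^ 4 * poly ?p w = \<gamma>\<^sup>2 + w * (2 * \<beta> * \<gamma> + w * (\<beta>\<^sup>2 + 2 * d\<^sup>2 * \<gamma> + w * (2 * d\<^sup>2 * \<beta>)))"
      unfolding scale by simp
    have R: "d ^ 4 * poly ?r w = - 3 * (f\<^sup>2 + g\<^sup>2 + w * (2 * g * (a (B0 k) * d) - 2 * f * (a (A0 k) * d)
        + w * ((a (A0 k) * d)\<^sup>2 + (a (B0 k) * d)\<^sup>2)))"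
      unfolding scale by simp
    have L: "(a (A1 k) + d * w) * (a (B1 k) + d * w) + (a (C k))\<^sup>2 = d\<^sup>2 * w\<^sup>2 + \<beta> * w + \<gamma>"
      unfolding \<beta>_def \<gamma>_def by algebra
    have N: "(a (C k) * a (B0 k) - a (A0 k) * (a (B1 k) + d * w)) = f - a (A0 k) * d * w"
      "(a (C k) * a (A0 k) + a (B0 k) * (a (A1 k) + d * w)) = g + a (B0 k) * d * w"
      unfolding f_def g_def by algebra+
    have "(d\<^sup>2 * w\<^sup>2 + \<beta> * w + \<gamma>)\<^sup>2 * (2 * z - w) =
        3 * ((f - a (A0 k) * d * w)\<^sup>2 + (g + a (B0 k) * d * w)\<^sup>2)"
      using eq unfolding L N s[symmetric] by algebra
    then have "d ^ 4 * w ^ 5 = 2 * (d ^ 4 * w ^ 4) * z + (2 * z - w) * (d ^ 4 * poly ?p w) + d ^ 4 * poly ?r w"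
      unfolding P R by algebra
    then have "d ^ 4 * w ^ 5 = d ^ 4 * (2 * w ^ 4 * z + (2 * z - w) * poly ?p w + poly ?r w)"
      by (simp only: algebra_simps)
    then show ?thesis using d by (simp only: mult_cancel_left simp_thms)
  qed
  moreover have "degree ?p \<le> 3" "degree ?r \<le> 4"
    by (intro degree_le allI impI; simp add: coeff_pCons split: nat.split)+
  ultimately show ?thesis unfolding d_def by blast
qed

text \<open>
  For general coefficients a solution is determined by its two values $w_k$, which satisfy two quintics.
\<close>

lemma for_general_at_most_25:
  assumes m: "CARD('m::finite) = 2" and n: "CARD('n::finite) = 1"
  shows "for_general (\<lambda>x :: ('n, 'm, 'n interaction) coeff \<Rightarrow> complex.
    finite (resonator_solutions x) \<and> card (resonator_solutions x) \<le> 25)"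
proof -
  obtain k l :: 'm where kl: "UNIV = {k, l}" "k \<noteq> l" using m by (auto simp: card_2_iff)
  obtain i :: 'n where i: "UNIV = {i}" using n by (auto simp: card_1_singleton_iff)
  define \<kappa> where "\<kappa> b = (if b then k else l)" for b
  have \<kappa>: "\<exists>b. j = \<kappa> b" for j using kl(1) by (auto simp: \<kappa>_def)
  have two: "(\<Sum>j\<in>UNIV. f j) = f k + f l" for f :: "'m \<Rightarrow> complex"
    unfolding kl(1) using kl(2) by simp
  define G where "G x = (\<Prod>j\<in>UNIV. x (Block i (D j)) *
      (x (Block i (A0 j)) * x (Block i (B0 j)) * (x (Block i (B1 j)) - x (Block i (A1 j)))
       - x (Block i (C j)) * ((x (Block i (A0 j)))\<^sup>2 + (x (Block i (B0 j)))\<^sup>2)))"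
    for x :: "('n, 'm, 'n interaction) coeff \<Rightarrow> complex"
  have "polyfun G" unfolding G_def[abs_def] by (intro polyfun_intros)
  moreover have "G (\<lambda>s. case s of Block i b \<Rightarrow> (case b of A1 j \<Rightarrow> 0 | C j \<Rightarrow> 0 | _ \<Rightarrow> 1) | _ \<Rightarrow> 0) \<noteq> 0"
    by (simp add: G_def)
  moreover have "finite (resonator_solutions x) \<and> card (resonator_solutions x) \<le> 25" if G: "G x \<noteq> 0" for x
  proof -
    define a where "a s = x (Block i s)" for s
    have a: "a (D j) \<noteq> 0"
      "a (A0 j) * a (B0 j) * (a (B1 j) - a (A1 j)) \<noteq> a (C j) * ((a (A0 j))\<^sup>2 + (a (B0 j))\<^sup>2)" for j
      using G by (auto simp: G_def a_def)
    define w where "w u v j = 2 * (\<Sum>j\<in>UNIV. intensity u v j) - intensity u v j" for u v :: "complex ^ 'm" and j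
    define h where "h s b = w (fst s $ i) (snd s $ i) (\<kappa> b)" for s :: "(complex ^ 'm ^ 'n) \<times> (complex ^ 'm ^ 'n)" and b
    have one: "i' = i" for i' :: 'n using UNIV_I[of i'] unfolding i by simp
    then have empty: "UNIV - {i'} = {}" for i' :: 'n by (metis Diff_cancel i)
    have sol: "block_p a (fst s $ i) (snd s $ i) j = 0" "block_q a (fst s $ i) (snd s $ i) j = 0"
      if "s \<in> resonator_solutions x" for s j
      using that by (auto simp: resonator_solutions_def a_def[abs_def] empty)
    have "\<exists>p r. degree p \<le> 3 \<and> degree r \<le> 4 \<and> (\<forall>z\<in>h ` resonator_solutions x.
        z b ^ 5 = 2 * z b ^ 4 * z (\<not> b) + (2 * z (\<not> b) - z b) * poly p (z b) + poly r (z b))" for b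
    proof -
      obtain p r where pr: "degree p \<le> 3" "degree r \<le> 4" and quintic: "\<And>w z s.
          ((a (A1 (\<kappa> b)) + a (D (\<kappa> b)) * w) * (a (B1 (\<kappa> b)) + a (D (\<kappa> b)) * w) + (a (C (\<kappa> b)))\<^sup>2)\<^sup>2 * s =
            (a (C (\<kappa> b)) * a (B0 (\<kappa> b)) - a (A0 (\<kappa> b)) * (a (B1 (\<kappa> b)) + a (D (\<kappa> b)) * w))\<^sup>2
            + (a (C (\<kappa> b)) * a (A0 (\<kappa> b)) + a (B0 (\<kappa> b)) * (a (A1 (\<kappa> b)) + a (D (\<kappa> b)) * w))\<^sup>2 \<Longrightarrow>
          3 * s = 2 * z - w \<Longrightarrow>
          w ^ 5 = 2 * w ^ 4 * z + (2 * z - w) * poly p w + poly r w"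
        using block_quintic[of a "\<kappa> b"] a(1) by blast
      have "h s b ^ 5 = 2 * h s b ^ 4 * h s (\<not> b) + (2 * h s (\<not> b) - h s b) * poly p (h s b) + poly r (h s b)"
        if s: "s \<in> resonator_solutions x" for s
      proof (rule quintic)
        show "((a (A1 (\<kappa> b)) + a (D (\<kappa> b)) * h s b) * (a (B1 (\<kappa> b)) + a (D (\<kappa> b)) * h s b) + (a (C (\<kappa> b)))\<^sup>2)\<^sup>2
            * intensity (fst s $ i) (snd s $ i) (\<kappa> b) =
            (a (C (\<kappa> b)) * a (B0 (\<kappa> b)) - a (A0 (\<kappa> b)) * (a (B1 (\<kappa> b)) + a (D (\<kappa> b)) * h s b))\<^sup>2
            + (a (C (\<kappa> b)) * a (A0 (\<kappa> b)) + a (B0 (\<kappa> b)) * (a (A1 (\<kappa> b)) + a (D (\<kappa> b)) * h s b))\<^sup>2"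
          unfolding h_def w_def by (rule block_solution_intensity[OF sol[OF s]])
        show "3 * intensity (fst s $ i) (snd s $ i) (\<kappa> b) = 2 * h s (\<not> b) - h s b"
          by (simp add: h_def w_def \<kappa>_def two)
      qed
      then show ?thesis using pr by blast
    qed
    then obtain p r where "\<And>b. degree (p b) \<le> 3" "\<And>b. degree (r b) \<le> 4"
      "\<And>z b. z \<in> h ` resonator_solutions x \<Longrightarrow>
        z b ^ 5 = 2 * z b ^ 4 * z (\<not> b) + (2 * z (\<not> b) - z b) * poly (p b) (z b) + poly (r b) (z b)"
      by metis
    then have image: "finite (h ` resonator_solutions x) \<and> card (h ` resonator_solutions x) \<le> 25"
      by (intro two_quintics) auto
    have "inj_on h (resonator_solutions x)"
    proof (rule inj_onI)
      fix s t assume s: "s \<in> resonator_solutions x" and t: "t \<in> resonator_solutions x" and "h s = h t"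
      have "fst s $ i $ j = fst t $ i $ j \<and> snd s $ i $ j = snd t $ i $ j" for j
      proof -
        obtain b where "j = \<kappa> b" using \<kappa> by blast
        then have wj: "w (fst s $ i) (snd s $ i) j = w (fst t $ i) (snd t $ i) j"
          using fun_cong[OF \<open>h s = h t\<close>, of b] by (simp add: h_def)
        let ?\<Delta> = "(a (A1 j) + a (D j) * w (fst t $ i) (snd t $ i) j) * (a (B1 j) + a (D j) * w (fst t $ i) (snd t $ i) j) + (a (C j))\<^sup>2"
        have "?\<Delta> \<noteq> 0"
          using block_solution_regular[OF sol[OF t] a(2)] by (simp add: w_def)
        moreover have "?\<Delta> * fst s $ i $ j = ?\<Delta> * fst t $ i $ j" "?\<Delta> * snd s $ i $ j = ?\<Delta> * snd t $ i $ j"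
          using block_solution_u[OF sol[OF s, of j]] block_solution_u[OF sol[OF t, of j]]
            block_solution_v[OF sol[OF s, of j]] block_solution_v[OF sol[OF t, of j]]
          unfolding w_def[symmetric] wj by simp_all
        ultimately show ?thesis by (simp only: mult_cancel_left simp_thms)
      qed
      then have "fst s $ i = fst t $ i" "snd s $ i = snd t $ i" by (simp_all add: vec_eq_iff)
      then have "fst s $ i' = fst t $ i'" "snd s $ i' = snd t $ i'" for i'
        unfolding one[of i'] by simp_all
      then show "s = t" by (simp add: prod_eq_iff vec_eq_iff)
    qed
    then show ?thesis using image by (metis card_image finite_imageD)
  qed
  ultimately show ?thesis unfolding for_general_iff by blast
qed

section \<open>Number of solutions\<close>

theorem proposition6p1:
  assumes "CARD('m::finite) \<ge> 2"
  shows "for_general (\<lambda>x :: ('n::finite, 'm, 'n interaction) coeff \<Rightarrow> complex.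
           at_least_elements (5 ^ (CARD('m) * CARD('n))) (resonator_solutions x)) \<and>
         for_general (\<lambda>x :: ('n, 'm, ('n, 'm) linear_coupling) coeff \<Rightarrow> complex.
           at_least_elements (5 ^ (CARD('m) * CARD('n))) (linearly_coupled_solutions x)) \<and>
         (CARD('m) = 2 \<and> CARD('n) = 1 \<longrightarrow>
           for_general (\<lambda>x :: ('n, 'm, 'n interaction) coeff \<Rightarrow> complex.
             finite (resonator_solutions x) \<and> card (resonator_solutions x) = 25))"
proof (intro conjI impI for_general_resonators for_general_linearly_coupled)
  assume "CARD('m) = 2 \<and> CARD('n) = 1"
  then have card: "CARD('m) = 2" "CARD('n) = 1" by simp_all
  show "for_general (\<lambda>x :: ('n, 'm, 'n interaction) coeff \<Rightarrow> complex.
      finite (resonator_solutions x) \<and> card (resonator_solutions x) = 25)"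
  proof (rule for_general_mono[OF for_general_conj[OF for_general_at_most_25[OF card] for_general_resonators]])
    fix x :: "('n, 'm, 'n interaction) coeff \<Rightarrow> complex"
    assume x: "(finite (resonator_solutions x) \<and> card (resonator_solutions x) \<le> 25) \<and>
      at_least_elements (5 ^ (CARD('m) * CARD('n))) (resonator_solutions x)"
    then obtain T where "T \<subseteq> resonator_solutions x" "card T = 25"
      unfolding at_least_elements_def card by auto
    then show "finite (resonator_solutions x) \<and> card (resonator_solutions x) = 25"
      using x card_mono[of "resonator_solutions x" T] by linarith
  qed
qed

end
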